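(* If $G$ is a nilpotent group with a balanced presentation and such that $\beta_1(G)=3$, then $G\cong\mathbb{Z}^3$.
   Context: A balanced presentation is a finite presentation with an equal number of generators and relations. $\beta_1(G)=\dim_{\mathbb{Q}}H_1(G;\mathbb{Q})$. *)

theory Defs
  imports
    "HOL-Algebra.AbelCoset"
    "HOL-Algebra.Elementary_Groups"
    HOL.Hull
    "HOL-Library.Poly_Mapping"
    "Jordan_Normal_Form.VS_Connect"
begin

section \<open>Nilpotent groups\<close>

definition commutator_subgroup :: "('a, 'b) monoid_scheme \<Rightarrow> 'a set \<Rightarrow> 'a set \<Rightarrow> 'a set" where
  "commutator_subgroup G H K =
     generate G (\<Union>h \<in> H. \<Union>k \<in> K. {h \<otimes>\<^bsub>G\<^esub> k \<otimes>\<^bsub>G\<^esub> inv\<^bsub>G\<^esub> h \<otimes>\<^bsub>G\<^esub> inv\<^bsub>G\<^esub> k})"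

primrec lower_central_series :: "('a, 'b) monoid_scheme \<Rightarrow> nat \<Rightarrow> 'a set" where
  "lower_central_series G 0 = carrier G"
| "lower_central_series G (Suc n) = commutator_subgroup G (lower_central_series G n) (carrier G)"

locale nilpotent_group = group G for G (structure) +
  assumes nilpotent: "\<exists>n. lower_central_series G n = {\<one>}"


section \<open>Free groups and presentations\<close>

text \<open>A letter \<open>(x, True)\<close> stands for the generator \<open>x\<close> and \<open>(x, False)\<close> for its inverse. Elements
  of a free group are the reduced words, multiplied by concatenation followed by cancellation.\<close>

type_synonym 'x letter = "'x \<times> bool"

definition inv_letter :: "'x letter \<Rightarrow> 'x letter" where
  "inv_letter p = (fst p, \<not> snd p)"

definition reduced_word :: "'x letter list \<Rightarrow> bool" where
  "reduced_word = successively (\<lambda>p q. q \<noteq> inv_letter p)"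

fun cancel_cons :: "'x letter \<Rightarrow> 'x letter list \<Rightarrow> 'x letter list" where
  "cancel_cons p [] = [p]"
| "cancel_cons p (q # w) = (if q = inv_letter p then w else p # q # w)"

definition free_group :: "'x set \<Rightarrow> 'x letter list monoid" where
  "free_group X =
     \<lparr>carrier = {w. reduced_word w \<and> fst ` set w \<subseteq> X}, monoid.mult = foldr cancel_cons, one = []\<rparr>"

definition normal_closure :: "('a, 'b) monoid_scheme \<Rightarrow> 'a set \<Rightarrow> 'a set" where
  "normal_closure G R = (\<lambda>N. N \<lhd> G) hull R"

definition presented_group :: "'x set \<Rightarrow> 'x letter list set \<Rightarrow> 'x letter list set monoid" where
  "presented_group X R = free_group X Mod normal_closure (free_group X) R"

text \<open>The relators form a finite family, so they are counted with repetition.\<close>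

definition has_balanced_presentation :: "('a, 'b) monoid_scheme \<Rightarrow> bool" where
  "has_balanced_presentation G \<longleftrightarrow>
     (\<exists>(n::nat) rs. set rs \<subseteq> carrier (free_group {..<n}) \<and> length rs = n \<and>
                    G \<cong> presented_group {..<n} (set rs))"

lemma inv_letter_inv_letter [simp]: "inv_letter (inv_letter p) = p"
  by (simp add: inv_letter_def)

lemma inv_letter_neq [simp]: "inv_letter p \<noteq> p" "p \<noteq> inv_letter p"
  by (simp_all add: inv_letter_def prod_eq_iff)

lemma fst_inv_letter [simp]: "fst (inv_letter p) = fst p"
  by (simp add: inv_letter_def)

lemma reduced_word_Nil [simp]: "reduced_word []"
  by (simp add: reduced_word_def)

lemma reduced_word_Cons:
  "reduced_word (p # w) \<longleftrightarrow> (w = [] \<or> hd w \<noteq> inv_letter p) \<and> reduced_word w"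
  by (auto simp: reduced_word_def successively_Cons)

lemma reduced_cancel_cons: "reduced_word w \<Longrightarrow> reduced_word (cancel_cons p w)"
  by (cases w) (auto simp: reduced_word_Cons)

lemma cancel_cons_inverse: "reduced_word w \<Longrightarrow> cancel_cons p (cancel_cons (inv_letter p) w) = w"
  by (cases w; cases "tl w") (auto simp: reduced_word_Cons)

lemma reduced_foldr_cancel_cons: "reduced_word v \<Longrightarrow> reduced_word (foldr cancel_cons u v)"
  by (induction u) (auto intro: reduced_cancel_cons)

lemma foldr_cancel_cons_cancel_cons:
  assumes "reduced_word w"
  shows "foldr cancel_cons (cancel_cons p u) w = cancel_cons p (foldr cancel_cons u w)"
  using assms by (cases u) (auto simp: cancel_cons_inverse reduced_foldr_cancel_cons)

lemma foldr_cancel_cons_assoc: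
  assumes "reduced_word w"
  shows "foldr cancel_cons (foldr cancel_cons u v) w = foldr cancel_cons u (foldr cancel_cons v w)"
  using assms by (induction u) (auto simp: foldr_cancel_cons_cancel_cons)

lemma foldr_cancel_cons_Nil: "reduced_word u \<Longrightarrow> foldr cancel_cons u [] = u"
proof (induction u)
  case (Cons p u)
  then show ?case
    by (cases u) (auto simp: reduced_word_Cons)
qed simp

lemma foldr_cancel_cons_inverse:
  "reduced_word w \<Longrightarrow> foldr cancel_cons (rev (map inv_letter u)) (foldr cancel_cons u w) = w"
proof (induction u)
  case (Cons p u)
  then show ?case
    using cancel_cons_inverse[of "foldr cancel_cons u w" "inv_letter p"]
    by (simp add: reduced_foldr_cancel_cons)
qed simp

lemma set_cancel_cons: "set (cancel_cons p w) \<subseteq> insert p (set w)"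
  by (cases w) auto

lemma set_foldr_cancel_cons: "set (foldr cancel_cons u v) \<subseteq> set u \<union> set v"
proof (induction u)
  case (Cons p u)
  then show ?case
    using set_cancel_cons[of p "foldr cancel_cons u v"] by auto
qed simp

lemma group_free_group: "group (free_group X)"
proof (rule groupI)
  fix u v assume "u \<in> carrier (free_group X)" "v \<in> carrier (free_group X)"
  then show "u \<otimes>\<^bsub>free_group X\<^esub> v \<in> carrier (free_group X)"
    using set_foldr_cancel_cons[of u v]
    by (fastforce simp: free_group_def reduced_foldr_cancel_cons)
next
  fix u assume u: "u \<in> carrier (free_group X)"
  define v where "v = foldr cancel_cons (rev (map inv_letter u)) []"
  have "v \<in> carrier (free_group X)"
    using u set_foldr_cancel_cons[of "rev (map inv_letter u)" "[]"]
    by (fastforce simp: free_group_def v_def reduced_foldr_cancel_cons)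
  moreover have "foldr cancel_cons v u = []"
    using u foldr_cancel_cons_inverse[of "[]" u]
    by (simp add: v_def free_group_def foldr_cancel_cons_assoc foldr_cancel_cons_Nil)
  ultimately show "\<exists>v\<in>carrier (free_group X). v \<otimes>\<^bsub>free_group X\<^esub> u = \<one>\<^bsub>free_group X\<^esub>"
    by (auto simp: free_group_def)
qed (auto simp: free_group_def foldr_cancel_cons_assoc)

lemma normal_normal_closure:
  assumes "group G" "R \<subseteq> carrier G"
  shows "normal_closure G R \<lhd> G"
proof -
  interpret group G by fact
  have "carrier G \<lhd> G"
    by (simp add: normal_inv_iff subgroup_self)
  with assms(2) show ?thesis
    unfolding normal_closure_def hull_def normal_inv_iff
    by (intro conjI subgroups_Inter) auto
qed


section \<open>Quotients of modules\<close>

definition quotient_module ::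
    "('r, 'm, 'c) module_scheme \<Rightarrow> 'm set \<Rightarrow> ('r, 'm set) module" where
  "quotient_module M N =
     \<lparr>carrier = a_rcosets\<^bsub>M\<^esub> N, monoid.mult = (\<lambda>_ _. N), one = N, zero = N, add = set_add M,
      smult = (\<lambda>c A. \<Union>v\<in>A. N +>\<^bsub>M\<^esub> (c \<odot>\<^bsub>M\<^esub> v))\<rparr>"
  \<comment> \<open>\<open>mult\<close> and \<open>one\<close> are unused fields of the record of modules\<close>

lemma module_quotient_module:
  assumes "Module.module R M" "submodule R N M"
  shows "Module.module R (quotient_module M N)"
proof -
  interpret Module.module R M by fact
  interpret N: submodule R N M by fact
  have minus: "\<ominus>\<^bsub>M\<^esub> x \<in> N" if "x \<in> N" for x
  proof -
    have "(\<ominus>\<^bsub>R\<^esub> \<one>\<^bsub>R\<^esub>) \<odot>\<^bsub>M\<^esub> x \<in> N"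
      using that by (intro N.smult_closed) auto
    then show ?thesis
      using smult_minus_1[of x] that N.subset by (metis subsetD)
  qed
  have "N \<noteq> {}"
    using N.zero_closed by blast
  then have "subgroup N (add_monoid M)"
    using minus N.subset by (intro add.subgroupI) (auto simp: a_inv_def[symmetric])
  then have "additive_subgroup N M"
    by (rule additive_subgroup.intro)
  then have "abelian_subgroup N M"
    by (rule abelian_subgroupI3[OF _ M.abelian_group_axioms])
  then interpret S: abelian_subgroup N M .
  let ?Q = "quotient_module M N"
  have carrier: "carrier ?Q = (\<lambda>x. N +>\<^bsub>M\<^esub> x) ` carrier M"
    by (auto simp: quotient_module_def A_RCOSETS_def')
  have zero: "\<zero>\<^bsub>?Q\<^esub> = N +>\<^bsub>M\<^esub> \<zero>\<^bsub>M\<^esub>"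
    using N.subset by (simp add: quotient_module_def)
  have add: "(N +>\<^bsub>M\<^esub> x) \<oplus>\<^bsub>?Q\<^esub> (N +>\<^bsub>M\<^esub> y) = N +>\<^bsub>M\<^esub> (x \<oplus>\<^bsub>M\<^esub> y)"
    if "x \<in> carrier M" "y \<in> carrier M" for x y
    using that by (simp add: quotient_module_def S.a_rcos_sum)
  have smult: "c \<odot>\<^bsub>?Q\<^esub> (N +>\<^bsub>M\<^esub> x) = N +>\<^bsub>M\<^esub> (c \<odot>\<^bsub>M\<^esub> x)"
    if c: "c \<in> carrier R" and x: "x \<in> carrier M" for c x
  proof -
    have eq: "N +>\<^bsub>M\<^esub> (c \<odot>\<^bsub>M\<^esub> v) = N +>\<^bsub>M\<^esub> (c \<odot>\<^bsub>M\<^esub> x)" if "v \<in> N +>\<^bsub>M\<^esub> x" for v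
    proof -
      from that obtain n where n: "n \<in> N" "v = n \<oplus>\<^bsub>M\<^esub> x"
        by (auto simp: a_r_coset_def')
      with c x N.subset have "c \<odot>\<^bsub>M\<^esub> v = c \<odot>\<^bsub>M\<^esub> n \<oplus>\<^bsub>M\<^esub> c \<odot>\<^bsub>M\<^esub> x"
        by (auto simp: smult_r_distr)
      with c n have "c \<odot>\<^bsub>M\<^esub> v \<in> N +>\<^bsub>M\<^esub> (c \<odot>\<^bsub>M\<^esub> x)"
        by (auto simp: a_r_coset_def')
      with c x S.a_repr_independence'[of "c \<odot>\<^bsub>M\<^esub> v" "c \<odot>\<^bsub>M\<^esub> x"] show ?thesis
        by simp
    qed
    have "c \<odot>\<^bsub>?Q\<^esub> (N +>\<^bsub>M\<^esub> x) = (\<Union>v\<in>N +>\<^bsub>M\<^esub> x. N +>\<^bsub>M\<^esub> (c \<odot>\<^bsub>M\<^esub> v))"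
      by (simp add: quotient_module_def)
    also have "\<dots> = (\<Union>v\<in>N +>\<^bsub>M\<^esub> x. N +>\<^bsub>M\<^esub> (c \<odot>\<^bsub>M\<^esub> x))"
      by (rule SUP_cong[OF refl eq])
    also have "\<dots> = N +>\<^bsub>M\<^esub> (c \<odot>\<^bsub>M\<^esub> x)"
      using S.a_rcos_self[OF x] by blast
    finally show ?thesis .
  qed
  show ?thesis
  proof (rule moduleI)
    show "abelian_group ?Q"
    proof (rule abelian_groupI)
      fix A assume "A \<in> carrier ?Q"
      then obtain x where x: "x \<in> carrier M" "A = N +>\<^bsub>M\<^esub> x"
        by (auto simp: carrier)
      then have "(N +>\<^bsub>M\<^esub> (\<ominus>\<^bsub>M\<^esub> x)) \<oplus>\<^bsub>?Q\<^esub> A = \<zero>\<^bsub>?Q\<^esub>"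
        by (simp add: add zero M.l_neg)
      with x show "\<exists>B\<in>carrier ?Q. B \<oplus>\<^bsub>?Q\<^esub> A = \<zero>\<^bsub>?Q\<^esub>"
        by (auto simp: carrier)
    qed (auto simp: carrier zero add M.a_ac)
  qed (auto simp: carrier add smult smult_l_distr smult_r_distr smult_assoc1 R.is_cring)
qed


section \<open>Rational homology of groups\<close>

text \<open>The inhomogeneous bar complex of \<open>G\<close> with trivial coefficients \<open>\<rat>\<close>: the \<open>n\<close>-chains are the
  finite rational combinations of \<open>n\<close>-tuples \<open>[g\<^sub>1|\<dots>|g\<^sub>n]\<close>, and the boundary of such a tuple is
  \<open>[g\<^sub>2|\<dots>|g\<^sub>n] + \<Sum>0<i<n. (-1)\<^sup>i [g\<^sub>1|\<dots>|g\<^sub>i g\<^sub>i\<^sub>+\<^sub>1|\<dots>|g\<^sub>n] + (-1)\<^sup>n [g\<^sub>1|\<dots>|g\<^sub>n\<^sub>-\<^sub>1]\<close>.\<close>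

definition bar_chains ::
    "('a, 'b) monoid_scheme \<Rightarrow> nat \<Rightarrow> (rat, 'a list \<Rightarrow>\<^sub>0 rat) module" where
  "bar_chains G n =
     \<lparr>carrier = {c. \<forall>gs \<in> Poly_Mapping.keys c. length gs = n \<and> set gs \<subseteq> carrier G},
      monoid.mult = (\<lambda>_ _. 0), one = 0, zero = 0, add = (+),
      smult = (\<lambda>q. Poly_Mapping.map ((*) q))\<rparr>"

text \<open>The \<open>i\<close>-th face, for \<open>i \<le> length gs\<close>. As list indices start from \<open>0\<close>, the first branch covers
  the entries \<open>g\<^sub>1, \<dots>, g\<^sub>i\<^sub>-\<^sub>1\<close>; face \<open>0\<close> drops the first entry and face \<open>length gs\<close> the last.\<close>

definition bar_face :: "('a, 'b) monoid_scheme \<Rightarrow> nat \<Rightarrow> 'a list \<Rightarrow> 'a list" where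
  "bar_face G i gs =
     map (\<lambda>k. if Suc k < i then gs ! k
              else if Suc k = i then gs ! k \<otimes>\<^bsub>G\<^esub> gs ! Suc k
              else gs ! Suc k) [0..<length gs - 1]"

definition bar_boundary ::
    "('a, 'b) monoid_scheme \<Rightarrow> ('a list \<Rightarrow>\<^sub>0 rat) \<Rightarrow> ('a list \<Rightarrow>\<^sub>0 rat)" where
  "bar_boundary G c =
     (\<Sum>gs \<in> Poly_Mapping.keys c - {[]}. \<Sum>i\<le>length gs.
        Poly_Mapping.single (bar_face G i gs) ((-1) ^ i * Poly_Mapping.lookup c gs))"
  \<comment> \<open>\<open>[]\<close> is left out since the boundary vanishes on \<open>0\<close>-chains\<close>

definition bar_cycles :: "('a, 'b) monoid_scheme \<Rightarrow> nat \<Rightarrow> ('a list \<Rightarrow>\<^sub>0 rat) set" where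
  "bar_cycles G n = {c \<in> carrier (bar_chains G n). bar_boundary G c = 0}"

definition bar_boundaries :: "('a, 'b) monoid_scheme \<Rightarrow> nat \<Rightarrow> ('a list \<Rightarrow>\<^sub>0 rat) set" where
  "bar_boundaries G n = bar_boundary G ` carrier (bar_chains G (Suc n))"

definition rat_homology ::
    "('a, 'b) monoid_scheme \<Rightarrow> nat \<Rightarrow> (rat, ('a list \<Rightarrow>\<^sub>0 rat) set) module" where
  "rat_homology G n =
     quotient_module (bar_chains G n\<lparr>carrier := bar_cycles G n\<rparr>) (bar_boundaries G n)"

lemma lookup_map_scale [simp]:
  fixes q :: rat
  shows "Poly_Mapping.lookup (Poly_Mapping.map ((*) q) c) x = q * Poly_Mapping.lookup c x"
  by (simp add: map.rep_eq when_def)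

lemma map_scale_zero [simp]:
  fixes q :: rat
  shows "Poly_Mapping.map ((*) q) 0 = 0"
  by (rule poly_mapping_eqI) simp

lemma vectorspace_bar_chains: "vectorspace class_ring (bar_chains G n)"
proof -
  have "Module.module class_ring (bar_chains G n)"
  proof (rule moduleI)
    show "abelian_group (bar_chains G n)"
    proof (rule abelian_groupI)
      fix c assume "c \<in> carrier (bar_chains G n)"
      then show "\<exists>d\<in>carrier (bar_chains G n). d \<oplus>\<^bsub>bar_chains G n\<^esub> c = \<zero>\<^bsub>bar_chains G n\<^esub>"
        by (intro bexI[of _ "- c"]) (auto simp: bar_chains_def in_keys_iff)
    qed (auto simp: bar_chains_def add_ac dest!: subsetD[OF Poly_Mapping.keys_add])
  qed (auto simp: bar_chains_def in_keys_iff lookup_add algebra_simps class_cring.is_cring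
         intro!: poly_mapping_eqI)
  then show ?thesis
    by (simp add: vectorspace_def class_field.field_axioms)
qed

lemma bar_boundary_eq:
  assumes "finite A" "Poly_Mapping.keys c \<subseteq> A"
  shows "bar_boundary G c =
    (\<Sum>gs \<in> A - {[]}. \<Sum>i\<le>length gs.
       Poly_Mapping.single (bar_face G i gs) ((-1) ^ i * Poly_Mapping.lookup c gs))"
  unfolding bar_boundary_def using assms by (intro sum.mono_neutral_left) (auto simp: in_keys_iff)

lemma bar_boundary_zero [simp]: "bar_boundary G 0 = 0"
  by (simp add: bar_boundary_def)

lemma bar_boundary_add: "bar_boundary G (c + d) = bar_boundary G c + bar_boundary G d"
proof -
  let ?A = "Poly_Mapping.keys c \<union> Poly_Mapping.keys d"
  have "Poly_Mapping.keys (c + d) \<subseteq> ?A"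
    by (rule Poly_Mapping.keys_add)
  then show ?thesis
    by (simp add: bar_boundary_eq[of ?A] lookup_add single_add distrib_left sum.distrib)
qed

lemma bar_boundary_sum: "bar_boundary G (sum f A) = (\<Sum>x\<in>A. bar_boundary G (f x))"
  by (induction A rule: infinite_finite_induct) (simp_all add: bar_boundary_add)

lemma bar_boundary_single:
  "bar_boundary G (Poly_Mapping.single gs q) =
     (if gs = [] then 0
      else \<Sum>i\<le>length gs. Poly_Mapping.single (bar_face G i gs) ((-1) ^ i * q))"
  using bar_boundary_eq[of "{gs}" "Poly_Mapping.single gs q" G] by auto

lemma bar_boundary_scale:
  "bar_boundary G (Poly_Mapping.map ((*) q) c) = Poly_Mapping.map ((*) q) (bar_boundary G c)"
proof -
  have map_add: "Poly_Mapping.map ((*) q) (a + b) =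
      Poly_Mapping.map ((*) q) a + Poly_Mapping.map ((*) q) b" for a b :: "'y \<Rightarrow>\<^sub>0 rat"
    by (rule poly_mapping_eqI) (simp add: lookup_add distrib_left)
  have map_eq: "Poly_Mapping.map ((*) q) (sum f A) = (\<Sum>x\<in>A. Poly_Mapping.map ((*) q) (f x))"
    for f :: "'x \<Rightarrow> 'y \<Rightarrow>\<^sub>0 rat" and A
    by (induction A rule: infinite_finite_induct)
       (simp_all add: map_add)
  have map_single: "Poly_Mapping.map ((*) q) (Poly_Mapping.single x r) = Poly_Mapping.single x (q * r)"
    for x :: 'y and r
    by (auto intro!: poly_mapping_eqI simp: lookup_single when_def)
  have "Poly_Mapping.keys (Poly_Mapping.map ((*) q) c) \<subseteq> Poly_Mapping.keys c"
    by (auto simp: in_keys_iff)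
  then show ?thesis
    by (simp add: bar_boundary_eq[of "Poly_Mapping.keys c"] map_eq map_single mult.left_commute)
qed

lemma length_bar_face [simp]: "length (bar_face G i gs) = length gs - 1"
  by (simp add: bar_face_def)

lemma set_bar_face:
  assumes "monoid G" "set gs \<subseteq> carrier G"
  shows "set (bar_face G i gs) \<subseteq> carrier G"
proof -
  interpret monoid G by fact
  have "gs ! k \<in> carrier G" if "k < length gs" for k
    using that assms(2) by auto
  then show ?thesis
    by (auto simp: bar_face_def)
qed

lemma bar_face_bar_face:
  assumes "monoid G" "set gs \<subseteq> carrier G" "j \<le> i" "i < length gs"
  shows "bar_face G j (bar_face G (Suc i) gs) = bar_face G i (bar_face G j gs)"
proof -
  interpret monoid G by fact
  have "gs ! k \<in> carrier G" if "k < length gs" for k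
    using that assms(2) by auto
  then show ?thesis
    using assms(3,4) by (intro nth_equalityI) (auto simp: bar_face_def m_assoc)
qed

lemma bar_boundary_closed:
  assumes "monoid G" "c \<in> carrier (bar_chains G (Suc n))"
  shows "bar_boundary G c \<in> carrier (bar_chains G n)"
proof -
  have keys: "length hs = n \<and> set hs \<subseteq> carrier G"
    if hs: "hs \<in> Poly_Mapping.keys (bar_boundary G c)" for hs
  proof -
    obtain gs i where "gs \<in> Poly_Mapping.keys c" "hs = bar_face G i gs"
      using hs unfolding bar_boundary_def
      by (fastforce dest!: subsetD[OF keys_sum] split: if_splits)
    with assms show ?thesis
      using set_bar_face[of G gs i] by (auto simp: bar_chains_def)
  qed
  then show ?thesis
    by (auto simp: bar_chains_def)
qed

lemma bar_boundary_bar_boundary_single: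
  assumes "monoid G" "set gs \<subseteq> carrier G"
  shows "bar_boundary G (bar_boundary G (Poly_Mapping.single gs q)) = 0"
proof (cases "length gs < 2")
  case True
  then have "gs = [] \<or> (\<exists>g. gs = [g])"
    by (cases gs) auto
  then show ?thesis
    by (auto simp: bar_boundary_single bar_boundary_sum bar_face_def)
next
  case False
  then obtain n where n: "length gs = Suc (Suc n)"
    by (metis One_nat_def Suc_1 less_2_cases_iff not0_implies_Suc)
  have nonempty: "bar_face G i gs \<noteq> []" for i
    using n length_bar_face[of G i gs] by force
  define f where
    "f = (\<lambda>(i, j). Poly_Mapping.single (bar_face G j (bar_face G i gs)) ((-1) ^ (i + j) * q))"
  let ?I = "{..Suc (Suc n)} \<times> {..Suc n}"
  let ?L = "{(i, j). j < i \<and> i \<le> Suc (Suc n)}" and ?U = "{(i, j). i \<le> j \<and> j \<le> Suc n}"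
  have "bar_boundary G (bar_boundary G (Poly_Mapping.single gs q)) = sum f ?I"
  proof -
    have "bar_boundary G (bar_boundary G (Poly_Mapping.single gs q)) =
        (\<Sum>i\<le>Suc (Suc n). \<Sum>j\<le>Suc n. f (i, j))"
      using n nonempty
      by (auto simp: bar_boundary_single bar_boundary_sum f_def power_add mult_ac
          simp del: sum.atMost_Suc intro!: sum.cong)
    then show ?thesis
      by (simp add: sum.cartesian_product del: sum.atMost_Suc)
  qed
  also have "?I = ?L \<union> ?U"
    by auto
  also have "sum f (?L \<union> ?U) = sum f ?L + sum f ?U"
    by (rule sum.union_disjoint)
       (auto intro: finite_subset[of _ "{..Suc (Suc n)} \<times> {..Suc (Suc n)}"])
  also have "sum f ?L = (\<Sum>p\<in>?U. - f p)"
  proof (rule sum.reindex_bij_witness[of _ "\<lambda>(i, j). (Suc j, i)" "\<lambda>(i, j). (j, i - 1)"], goal_cases)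
    case (5 p)
    then obtain i j where p: "p = (Suc i, j)" "j \<le> i" "i < length gs"
      using n by (cases p; cases "fst p") auto
    then show ?case
      using bar_face_bar_face[OF assms, of j i] by (simp add: f_def single_uminus add.commute)
  qed auto
  finally show ?thesis
    by (simp add: sum_negf)
qed

lemma poly_mapping_eq_sum_single:
  "c = (\<Sum>x\<in>Poly_Mapping.keys c. Poly_Mapping.single x (Poly_Mapping.lookup c x))"
  by (rule poly_mapping_eqI) (auto simp: lookup_sum lookup_single when_def in_keys_iff)

lemma bar_boundary_bar_boundary:
  assumes "monoid G" "c \<in> carrier (bar_chains G n)"
  shows "bar_boundary G (bar_boundary G c) = 0"
proof -
  have "bar_boundary G (bar_boundary G (Poly_Mapping.single gs (Poly_Mapping.lookup c gs))) = 0"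
    if "gs \<in> Poly_Mapping.keys c" for gs
    using that assms by (intro bar_boundary_bar_boundary_single) (auto simp: bar_chains_def)
  then show ?thesis
    by (subst poly_mapping_eq_sum_single) (simp add: bar_boundary_sum)
qed

lemma vectorspace_bar_cycles:
  "vectorspace class_ring (bar_chains G n\<lparr>carrier := bar_cycles G n\<rparr>)"
proof -
  interpret vectorspace class_ring "bar_chains G n"
    by (rule vectorspace_bar_chains)
  have "submodule class_ring (bar_cycles G n) (bar_chains G n)"
  proof
    show "c \<oplus>\<^bsub>bar_chains G n\<^esub> d \<in> bar_cycles G n"
      if "c \<in> bar_cycles G n" "d \<in> bar_cycles G n" for c d
      using that M.a_closed[of c d] by (auto simp: bar_cycles_def bar_chains_def bar_boundary_add)
    show "q \<odot>\<^bsub>bar_chains G n\<^esub> c \<in> bar_cycles G n"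
      if "q \<in> carrier class_ring" "c \<in> bar_cycles G n" for q c
      using that smult_closed[of q c] by (auto simp: bar_cycles_def bar_chains_def bar_boundary_scale)
  qed (auto simp: bar_cycles_def bar_chains_def)
  then show ?thesis
    by (auto intro!: subspace_is_vs subspace.intro vectorspace_bar_chains)
qed

lemma vectorspace_rat_homology:
  assumes "monoid G"
  shows "vectorspace class_ring (rat_homology G n)"
proof -
  let ?Z = "bar_chains G n\<lparr>carrier := bar_cycles G n\<rparr>"
  interpret C: vectorspace class_ring "bar_chains G (Suc n)"
    by (rule vectorspace_bar_chains)
  interpret Z: vectorspace class_ring ?Z
    by (rule vectorspace_bar_cycles)
  have "submodule class_ring (bar_boundaries G n) ?Z"
  proof
    show "bar_boundaries G n \<subseteq> carrier ?Z"
      using assms by (auto simp: bar_boundaries_def bar_cycles_def bar_boundary_closed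
          bar_boundary_bar_boundary)
    show "\<zero>\<^bsub>?Z\<^esub> \<in> bar_boundaries G n"
      unfolding bar_boundaries_def
      by (intro image_eqI[of _ _ 0]) (auto simp: bar_chains_def)
    show "a \<oplus>\<^bsub>?Z\<^esub> b \<in> bar_boundaries G n"
      if ab: "a \<in> bar_boundaries G n" "b \<in> bar_boundaries G n" for a b
    proof -
      obtain c d where c: "c \<in> carrier (bar_chains G (Suc n))" "a = bar_boundary G c"
        and d: "d \<in> carrier (bar_chains G (Suc n))" "b = bar_boundary G d"
        using ab unfolding bar_boundaries_def by blast
      have "c + d \<in> carrier (bar_chains G (Suc n))"
        using C.M.a_closed[OF c(1) d(1)] by (simp add: bar_chains_def)
      moreover have "a \<oplus>\<^bsub>?Z\<^esub> b = bar_boundary G (c + d)"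
        using c(2) d(2) by (simp add: bar_chains_def bar_boundary_add)
      ultimately show ?thesis
        unfolding bar_boundaries_def by blast
    qed
    show "q \<odot>\<^bsub>?Z\<^esub> a \<in> bar_boundaries G n"
      if qa: "q \<in> carrier class_ring" "a \<in> bar_boundaries G n" for q a
    proof -
      obtain c where c: "c \<in> carrier (bar_chains G (Suc n))" "a = bar_boundary G c"
        using qa unfolding bar_boundaries_def by blast
      have "Poly_Mapping.map ((*) q) c \<in> carrier (bar_chains G (Suc n))"
        using C.smult_closed[OF qa(1) c(1)] by (simp add: bar_chains_def)
      moreover have "q \<odot>\<^bsub>?Z\<^esub> a = bar_boundary G (Poly_Mapping.map ((*) q) c)"
        using c(2) by (simp add: bar_chains_def bar_boundary_scale)
      ultimately show ?thesis
        unfolding bar_boundaries_def by blast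
    qed
  qed
  then have "Module.module class_ring (rat_homology G n)"
    unfolding rat_homology_def by (intro module_quotient_module Z.module_axioms)
  then show ?thesis
    by (simp add: vectorspace_def class_field.field_axioms)
qed

text \<open>\<open>vectorspace.dim\<close> is the least size of a finite generating set, so \<open>betti_number\<close> is only
  meaningful for finite-dimensional homology, as is the case in degree \<open>1\<close> for finitely generated
  groups.\<close>

definition betti_number :: "('a, 'b) monoid_scheme \<Rightarrow> nat \<Rightarrow> nat" where
  "betti_number G n = vectorspace.dim class_ring (rat_homology G n)"

end

theory Submission
  imports
    Defs
    "HOL-Computational_Algebra.Polynomial_Factorial"
    "HOL-Algebra.Free_Abelian_Groups"
    "HOL-Library.Product_Plus"
begin

text \<open>Let \<open>G\<close> be generated by \<open>x\<^sub>1, \<dots>, x\<^sub>n\<close> with relators \<open>r\<^sub>1, \<dots>, r\<^sub>n\<close>. As \<open>H\<^sub>1(G; \<rat>)\<close> has dimension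
  \<open>3\<close>, its coordinates give, after clearing denominators, a homomorphism \<open>\<theta>\<close> from \<open>G\<close> to \<open>\<int>\<^sup>3\<close> whose
  image contains \<open>a \<int>\<^sup>3\<close> for some \<open>a > 0\<close> (\<open>homomorphism_of_betti_number_3\<close>). The point is that the
  kernel \<open>K\<close> of \<open>\<theta>\<close> is trivial. Then \<open>G\<close> is a subgroup of finite index in \<open>\<int>\<^sup>3\<close>, hence itself
  isomorphic to \<open>\<int>\<^sup>3\<close> (\<open>iso_integers_cubed\<close>).

  Let \<open>\<Lambda> = \<int>[\<int>\<^sup>3]\<close> be the ring of Laurent polynomials in three variables, and let \<open>D w\<close> in
  \<open>\<Lambda>\<^sup>n\<close> be the vector of Fox derivatives of a word \<open>w\<close>: the chain traced out by the lift of \<open>w\<close>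
  to the covering of the presentation complex that belongs to \<open>\<theta>\<close>. The vectors \<open>D r\<^sub>j\<close> are the columns
  of a square matrix \<open>A\<close> with image \<open>N\<close>. Three facts are combined.

  (1) If \<open>w\<close> represents an element of \<open>K\<close> and \<open>D w\<close> lies in \<open>N\<close>, then \<open>w\<close> represents an element of
  the commutator subgroup \<open>[K, K]\<close>, up to conjugation (\<open>relation_span_imp_derived\<close>); this is the
  Magnus--Blanchfield--Lyndon description of the abelianisation of \<open>K\<close>.

  (2) If \<open>G\<close> has class \<open>c\<close> and \<open>w\<close> represents an element of \<open>K\<close>, then every \<open>c\<close>-fold commutator
  \<open>[[w, g], \<dots>, g]\<close> is a consequence of the relators. As \<open>D [w, g] = (1 - \<theta>(g)) D w\<close>, this puts
  \<open>(\<theta>(g) - 1)\<^sup>c D w\<close> into \<open>N\<close> (\<open>relation_span_contains_nilpotent_multiple\<close>). So \<open>f D w\<close>, \<open>g D w\<close>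
  and \<open>h D w\<close> all lie in \<open>N\<close>, where \<open>f\<close>, \<open>g\<close>, \<open>h\<close> are the \<open>c\<close>-th powers of \<open>z\<^sup>a - 1\<close>, \<open>y\<^sup>a - 1\<close>,
  \<open>x\<^sup>a - 1\<close>.

  (3) If \<open>f w\<close>, \<open>g w\<close>, \<open>h w\<close> lie in \<open>N\<close>, then so does \<open>w\<close>
  (\<open>image_of_square_matrix_saturated\<close>). By (2), \<open>N\<close> contains nonzero multiples of the vectors
  \<open>D [x\<^sub>p, x\<^sub>q]\<close>, which span a space of dimension \<open>n - 1\<close>; since \<open>A\<close> is square, its kernel has rank at
  most \<open>1\<close>, and it is free because \<open>\<Lambda>\<close> is factorial. Thus \<open>N\<close> has a free resolution of length
  \<open>1\<close>, and along a regular sequence of length \<open>3\<close> such as \<open>f\<close>, \<open>g\<close>, \<open>h\<close> it has depth at least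
  \<open>2\<close>. The proof below is this depth count written out with explicit syzygies.

  Together they show \<open>K = [K, K]\<close>, and a perfect subgroup of a nilpotent group is trivial.\<close>


section \<open>Square matrices over factorial rings\<close>


text \<open>Elimination without division: after cross-multiplying with a pivot, the last equation is
  absorbed and the remaining ones have one unknown less.\<close>

lemma underdetermined_system_has_nontrivial_solution:
  fixes a :: "nat \<Rightarrow> 'k \<Rightarrow> 'a::idom"
  assumes "finite S" "n < card S"
  shows "\<exists>c. (\<exists>k\<in>S. c k \<noteq> 0) \<and> (\<forall>i<n. (\<Sum>k\<in>S. a i k * c k) = 0)"
  using assms
proof (induction n arbitrary: a S)
  case 0
  then have "S \<noteq> {}" by auto
  then show ?case
    by (intro exI[of _ "\<lambda>_. 1"]) auto
next
  case (Suc n)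
  show ?case
  proof (cases "\<forall>k\<in>S. a n k = 0")
    case True
    obtain c where "\<exists>k\<in>S. c k \<noteq> 0" "\<forall>i<n. (\<Sum>k\<in>S. a i k * c k) = 0"
      using Suc.IH[of S a] Suc.prems by auto
    with True show ?thesis
      by (intro exI[of _ c]) (auto simp: less_Suc_eq)
  next
    case False
    then obtain p where p: "p \<in> S" "a n p \<noteq> 0"
      by blast
    let ?S = "S - {p}"
    have "n < card ?S"
      using Suc.prems p by simp
    moreover have "finite ?S"
      using Suc.prems by simp
    ultimately obtain c where c: "\<exists>k\<in>?S. c k \<noteq> 0"
      "\<forall>i<n. (\<Sum>k\<in>?S. (a n p * a i k - a i p * a n k) * c k) = 0"
      using Suc.IH[of ?S "\<lambda>i k. a n p * a i k - a i p * a n k"] by blast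
    define c' where "c' k = (if k = p then - (\<Sum>k\<in>?S. a n k * c k) else a n p * c k)" for k
    have split: "(\<Sum>k\<in>S. a i k * c' k) = (\<Sum>k\<in>?S. (a n p * a i k - a i p * a n k) * c k)" for i
    proof -
      have "(\<Sum>k\<in>S. a i k * c' k) = a i p * c' p + (\<Sum>k\<in>?S. a i k * c' k)"
        using Suc.prems p by (simp add: sum.remove)
      also have "(\<Sum>k\<in>?S. a i k * c' k) = (\<Sum>k\<in>?S. a n p * a i k * c k)"
        by (rule sum.cong) (auto simp: c'_def)
      finally show ?thesis
        by (simp add: c'_def left_diff_distrib sum_subtractf sum_distrib_left mult.assoc)
    qed
    have "(\<Sum>k\<in>S. a i k * c' k) = 0" if "i < Suc n" for i
      using that c(2) unfolding split by (cases "i = n") auto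
    moreover have "\<exists>k\<in>S. c' k \<noteq> 0"
      using c(1) p by (auto simp: c'_def)
    ultimately show ?thesis
      by blast
  qed
qed

text \<open>The hypothesis on \<open>t\<close> says that the image of the square matrix \<open>A\<close> contains \<open>n - 1\<close> vectors,
  independent over the field of fractions: the nonzero multiples by \<open>f\<close> of the Koszul vectors
  \<open>b\<^sub>p e\<^sub>q - b\<^sub>q e\<^sub>p\<close>. So the kernel has rank at most \<open>1\<close>.\<close>

lemma kernel_vectors_proportional:
  fixes A :: "nat \<Rightarrow> nat \<Rightarrow> 'a::idom"
  assumes f: "f \<noteq> 0" and p: "p < n" "b p \<noteq> 0"
    and t: "\<And>q i. q < n \<Longrightarrow> q \<noteq> p \<Longrightarrow> i < n \<Longrightarrow>
      (\<Sum>j<n. A i j * t q j) = f * (if i = q then b p else if i = p then - b q else 0)"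
    and u: "\<And>i. i < n \<Longrightarrow> (\<Sum>j<n. A i j * u j) = 0"
    and v: "\<And>i. i < n \<Longrightarrow> (\<Sum>j<n. A i j * v j) = 0"
    and ij: "i < n" "j < n"
  shows "u i * v j = u j * v i"
proof -
  \<comment> \<open>the \<open>n + 1\<close> columns of \<open>y\<close> are \<open>u\<close> in place \<open>p\<close>, \<open>v\<close> in place \<open>n\<close> and \<open>t q\<close> elsewhere; a linear
    relation between them is mapped by \<open>A\<close> to one between independent vectors\<close>
  define y where "y j k = (if k = p then u j else if k = n then v j else t k j)" for j k
  obtain c where nz: "\<exists>k\<in>{..n}. c k \<noteq> 0" and c: "\<forall>j<n. (\<Sum>k\<le>n. y j k * c k) = 0"
    using underdetermined_system_has_nontrivial_solution[of "{..n}" n y] by auto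
  have zero: "c q = 0" if q: "q < n" "q \<noteq> p" for q
  proof -
    have "0 = (\<Sum>j<n. A q j * (\<Sum>k\<le>n. y j k * c k))"
      using c by simp
    also have "\<dots> = (\<Sum>k\<le>n. (\<Sum>j<n. A q j * y j k) * c k)"
      unfolding sum_distrib_left sum_distrib_right by (subst sum.swap) (simp add: mult.assoc)
    also have "\<dots> = (\<Sum>k\<le>n. if k = q then f * b p * c q else 0)"
    proof (rule sum.cong[OF refl])
      fix k assume "k \<in> {..n}"
      then consider "k = p" | "k = n" "k \<noteq> p" | "k < n" "k \<noteq> p"
        by force
      then show "(\<Sum>j<n. A q j * y j k) * c k = (if k = q then f * b p * c q else 0)"
        using q u v t by cases (auto simp: y_def)
    qed
    also have "\<dots> = f * b p * c q"
      using q by simp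
    finally show ?thesis
      using f p by simp
  qed
  have rel: "u k * c p + v k * c n = 0" if "k < n" for k
  proof -
    have "0 = (\<Sum>l\<le>n. y k l * c l)"
      using c that by simp
    also have "\<dots> = (\<Sum>l\<in>{p, n}. y k l * c l)"
    proof (rule sum.mono_neutral_right)
      show "\<forall>l\<in>{..n} - {p, n}. y k l * c l = 0"
        using zero by auto
    qed (use p in auto)
    finally show ?thesis
      using p by (simp add: y_def)
  qed
  have nz': "c p \<noteq> 0 \<or> c n \<noteq> 0"
    using nz zero by (metis atMost_iff le_neq_implies_less)
  have "c p * (u i * v j - u j * v i) = v j * (u i * c p + v i * c n) - v i * (u j * c p + v j * c n)"
       "c n * (u i * v j - u j * v i) = u i * (u j * c p + v j * c n) - u j * (u i * c p + v i * c n)"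
    by (simp_all add: algebra_simps)
  then show ?thesis
    using nz' rel[OF ij(1)] rel[OF ij(2)] by auto
qed

text \<open>Over a factorial ring a line of vectors is generated by a primitive one, obtained from any
  nonzero vector by dividing out the common divisor of its entries. The second conclusion puts the
  generator into \<open>Z\<close> whenever \<open>Z\<close> is saturated, as the kernel of a matrix is.\<close>

lemma rank_one_module_generated_by_primitive_vector:
  fixes Z :: "(nat \<Rightarrow> 'a::factorial_ring_gcd) set"
  assumes par: "\<And>u v i j. u \<in> Z \<Longrightarrow> v \<in> Z \<Longrightarrow> i < n \<Longrightarrow> j < n \<Longrightarrow> u i * v j = u j * v i"
  obtains v where "\<And>u. u \<in> Z \<Longrightarrow> \<exists>c. \<forall>i<n. u i = c * v i"
    and "v = (\<lambda>_. 0) \<or> (\<exists>u\<in>Z. \<exists>d. d \<noteq> 0 \<and> (\<forall>i<n. u i = d * v i))"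
proof (cases "\<forall>u\<in>Z. \<forall>i<n. u i = 0")
  case True
  then show ?thesis
    by (intro that[of "\<lambda>_. 0"]) auto
next
  case False
  then obtain w k where w: "w \<in> Z" "k < n" "w k \<noteq> 0"
    by blast
  define d where "d = Gcd\<^sub>f\<^sub>i\<^sub>n (w ` {..<n})"
  have d: "d dvd w i" if "i < n" for i
    using that unfolding d_def by (intro Gcd_fin_dvd) auto
  define v where "v i = w i div d" for i
  have v: "w i = d * v i" if "i < n" for i
    using d[OF that] by (simp add: v_def)
  have d0: "d \<noteq> 0"
    using v w by force
  have prim: "x dvd 1" if "\<And>i. i < n \<Longrightarrow> x dvd v i" for x
  proof -
    have "d * x dvd d"
      unfolding d_def
    proof (rule Gcd_fin_greatest)
      fix y assume "y \<in> w ` {..<n}"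
      then obtain i where i: "i < n" "y = w i"
        by blast
      then have "d * x dvd y"
        using mult_dvd_mono[OF dvd_refl that[OF i(1)], of d] v[OF i(1)] by simp
      then show "Gcd\<^sub>f\<^sub>i\<^sub>n (w ` {..<n}) * x dvd y"
        by (simp only: d_def)
    qed auto
    then show ?thesis
      using d0 by simp
  qed
  show ?thesis
  proof (rule that[of v])
    show "v = (\<lambda>_. 0) \<or> (\<exists>u\<in>Z. \<exists>d. d \<noteq> 0 \<and> (\<forall>i<n. u i = d * v i))"
      using w d0 v by blast
    fix u assume u: "u \<in> Z"
    have vk: "v k \<noteq> 0"
      using w v by force
    have uv: "u i * v j = u j * v i" if "i < n" "j < n" for i j
    proof -
      have "d * (u i * v j) = d * (u j * v i)"
        using par[OF u w(1) that] v that by (simp add: algebra_simps)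
      then show ?thesis
        using d0 by simp
    qed
    \<comment> \<open>clear the common factor of \<open>u k\<close> and \<open>v k\<close>: the rest of \<open>v k\<close> divides all entries of \<open>v\<close>\<close>
    define e where "e = gcd (u k) (v k)"
    have e0: "e \<noteq> 0"
      using vk by (simp add: e_def)
    obtain x y where xy: "u k = e * x" "v k = e * y" "coprime x y"
      using gcd_coprime_exists[OF e0[unfolded e_def]] unfolding e_def by (metis mult.commute)
    have y: "y dvd v i" if "i < n" for i
    proof -
      have "u i * (e * y) = e * x * v i"
        using uv[OF that w(2)] by (simp only: xy)
      then have "e * (u i * y) = e * (x * v i)"
        by (simp only: mult.assoc mult.left_commute)
      then have "u i * y = x * v i"
        using e0 by simp
      then have "y dvd x * v i"
        by (metis dvd_triv_right)
      then show ?thesis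
        using xy(3) by (simp add: coprime_commute coprime_dvd_mult_right_iff)
    qed
    then have "y dvd 1"
      by (rule prim)
    then obtain z where z: "1 = y * z" ..
    have "u i = (x * z) * v i" if "i < n" for i
    proof -
      have "v k * u i = v k * (x * z * v i)"
      proof -
        have "v k * u i = e * x * v i"
          using uv[OF that w(2)] by (simp only: xy mult.commute)
        also have "\<dots> = e * x * v i * (y * z)"
          unfolding z[symmetric] by simp
        also have "\<dots> = v k * (x * z * v i)"
          using xy by (simp add: algebra_simps)
        finally show ?thesis .
      qed
      then show ?thesis
        using vk by simp
    qed
    then show "\<exists>c. \<forall>i<n. u i = c * v i"
      by blast
  qed
qed

text \<open>Let \<open>f w = A u\<^sub>1\<close>, \<open>g w = A u\<^sub>2\<close>, \<open>h w = A u\<^sub>3\<close>, and let \<open>v\<close> generate the kernel of \<open>A\<close>. Then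
  \<open>g u\<^sub>1 - f u\<^sub>2 = c v\<close>, and comparing this with the two analogous equations gives that \<open>h c\<close> lies
  in the ideal \<open>(f, g)\<close>. By regularity \<open>c = g r + f s\<close>, so \<open>g (u\<^sub>1 - r v)\<close> is divisible by \<open>f\<close>,
  hence so is \<open>u\<^sub>1 - r v\<close>. If \<open>u\<^sub>1 - r v = f x\<close>, then \<open>f w = A (u\<^sub>1 - r v) = f A x\<close> and
  \<open>w = A x\<close>.\<close>

lemma image_of_square_matrix_saturated:
  fixes A :: "nat \<Rightarrow> nat \<Rightarrow> 'a::factorial_ring_gcd"
  assumes f0: "f \<noteq> 0" and p: "p < n" "b p \<noteq> 0"
    and fg: "\<And>x. f dvd g * x \<Longrightarrow> f dvd x"
    and fgh: "\<And>x. \<exists>r s. h * x = g * r + f * s \<Longrightarrow> \<exists>r s. x = g * r + f * s"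
    and rank: "\<And>q. q < n \<Longrightarrow> q \<noteq> p \<Longrightarrow> \<exists>t. \<forall>i<n.
      (\<Sum>j<n. A i j * t j) = f * (if i = q then b p else if i = p then - b q else 0)"
    and w: "\<And>e. e \<in> {f, g, h} \<Longrightarrow> \<exists>u. \<forall>i<n. (\<Sum>j<n. A i j * u j) = e * w i"
  shows "\<exists>u. \<forall>i<n. (\<Sum>j<n. A i j * u j) = w i"
proof -
  define good where "good q t \<longleftrightarrow> (\<forall>i<n. (\<Sum>j<n. A i j * t j) =
      f * (if i = q then b p else if i = p then - b q else 0))" for q t
  have "\<forall>q\<in>{..<n} - {p}. \<exists>t. good q t"
    using rank by (auto simp: good_def)
  from bchoice[OF this] obtain t where "\<forall>q\<in>{..<n} - {p}. good q (t q)" ..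
  then have t: "(\<Sum>j<n. A i j * t q j) = f * (if i = q then b p else if i = p then - b q else 0)"
    if "q < n" "q \<noteq> p" "i < n" for q i
    using that by (simp add: good_def)
  define Z where "Z = {u. \<forall>i<n. (\<Sum>j<n. A i j * u j) = 0}"
  have "u i * v j = u j * v i" if "u \<in> Z" "v \<in> Z" "i < n" "j < n" for u v i j
  proof (rule kernel_vectors_proportional[where A = A and t = t and u = u and v = v and b = b and f = f])
    show "(\<Sum>j<n. A k j * u j) = 0" if "k < n" for k
      using \<open>u \<in> Z\<close> that by (simp add: Z_def)
    show "(\<Sum>j<n. A k j * v j) = 0" if "k < n" for k
      using \<open>v \<in> Z\<close> that by (simp add: Z_def)
    show "f \<noteq> 0" "p < n" "b p \<noteq> 0" "i < n" "j < n"
      using f0 p that by auto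
  qed (rule t)
  then obtain v where gen: "\<And>u. u \<in> Z \<Longrightarrow> \<exists>c. \<forall>i<n. u i = c * v i"
    and v: "v = (\<lambda>_. 0) \<or> (\<exists>u\<in>Z. \<exists>d. d \<noteq> 0 \<and> (\<forall>i<n. u i = d * v i))"
    by (rule rank_one_module_generated_by_primitive_vector) (assumption+, rule that)
  have vZ: "(\<Sum>j<n. A i j * v j) = 0" if "i < n" for i
    using v
  proof
    assume "\<exists>u\<in>Z. \<exists>d. d \<noteq> 0 \<and> (\<forall>i<n. u i = d * v i)"
    then obtain u d where u: "u \<in> Z" "d \<noteq> 0" "\<forall>i<n. u i = d * v i"
      by blast
    then have "0 = (\<Sum>j<n. A i j * (d * v j))"
      using that by (simp add: Z_def)
    also have "\<dots> = d * (\<Sum>j<n. A i j * v j)"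
      by (simp add: sum_distrib_left mult.left_commute)
    finally show ?thesis
      using u by simp
  qed simp
  obtain u1 where u1: "\<And>i. i < n \<Longrightarrow> (\<Sum>j<n. A i j * u1 j) = f * w i"
    using w[of f] by auto
  obtain u2 where u2: "\<And>i. i < n \<Longrightarrow> (\<Sum>j<n. A i j * u2 j) = g * w i"
    using w[of g] by auto
  obtain u3 where u3: "\<And>i. i < n \<Longrightarrow> (\<Sum>j<n. A i j * u3 j) = h * w i"
    using w[of h] by auto
  \<comment> \<open>two ways of writing \<open>x y w\<close> as an element of the image differ by an element of the kernel\<close>
  have syz: "\<exists>c. \<forall>i<n. y * u i - x * u' i = c * v i"
    if "\<And>i. i < n \<Longrightarrow> (\<Sum>j<n. A i j * u j) = x * w i"
       "\<And>i. i < n \<Longrightarrow> (\<Sum>j<n. A i j * u' j) = y * w i" for x y u u'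
  proof (rule gen)
    have "(\<Sum>j<n. A i j * (y * u j - x * u' j)) = 0" if "i < n" for i
    proof -
      have "(\<Sum>j<n. A i j * (y * u j - x * u' j)) = y * (\<Sum>j<n. A i j * u j) - x * (\<Sum>j<n. A i j * u' j)"
        by (simp add: right_diff_distrib sum_subtractf sum_distrib_left mult.left_commute)
      then show ?thesis
        using that \<open>\<And>i. i < n \<Longrightarrow> (\<Sum>j<n. A i j * u j) = x * w i\<close>
          \<open>\<And>i. i < n \<Longrightarrow> (\<Sum>j<n. A i j * u' j) = y * w i\<close> by (simp add: algebra_simps)
    qed
    then show "(\<lambda>j. y * u j - x * u' j) \<in> Z"
      by (simp add: Z_def)
  qed
  obtain c12 where c12: "\<And>i. i < n \<Longrightarrow> g * u1 i - f * u2 i = c12 * v i"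
    using syz[OF u1 u2] by auto
  obtain c13 where c13: "\<And>i. i < n \<Longrightarrow> h * u1 i - f * u3 i = c13 * v i"
    using syz[OF u1 u3] by auto
  obtain c23 where c23: "\<And>i. i < n \<Longrightarrow> h * u2 i - g * u3 i = c23 * v i"
    using syz[OF u2 u3] by auto
  obtain r where r: "\<And>i. i < n \<Longrightarrow> f dvd u1 i - r * v i"
  proof (cases "\<forall>i<n. v i = 0")
    case True
    have "f dvd u1 i - 0 * v i" if "i < n" for i
    proof -
      have "g * u1 i = f * u2 i"
        using c12[OF that] True that by simp
      then have "f dvd g * u1 i"
        by simp
      then have "f dvd u1 i"
        by (rule fg)
      then show ?thesis
        by simp
    qed
    then show ?thesis
      by (rule that)
  next
    case False
    then obtain k where k: "k < n" "v k \<noteq> 0"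
      by blast
    have "(h * c12 - g * c13 + f * c23) * v k =
        h * (c12 * v k) - g * (c13 * v k) + f * (c23 * v k)"
      by (simp add: algebra_simps)
    also have "\<dots> = 0"
      unfolding c12[OF k(1), symmetric] c13[OF k(1), symmetric] c23[OF k(1), symmetric]
      by (simp add: algebra_simps)
    finally have "h * c12 - g * c13 + f * c23 = 0"
      using k by simp
    moreover have "h * c12 - g * c13 + f * c23 = h * c12 - (g * c13 + f * (- c23))"
      by simp
    ultimately have "h * c12 = g * c13 + f * (- c23)"
      by (metis eq_iff_diff_eq_0)
    then obtain r s where rs: "c12 = g * r + f * s"
      using fgh[of c12] by blast
    show ?thesis
    proof (rule that[of r])
      fix i assume "i < n"
      then have "g * u1 i - f * u2 i = (g * r + f * s) * v i"
        using c12 rs by simp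
      moreover have "g * (u1 i - r * v i) - f * (u2 i + s * v i) =
          g * u1 i - f * u2 i - (g * r + f * s) * v i"
        by (simp add: algebra_simps)
      ultimately have "g * (u1 i - r * v i) = f * (u2 i + s * v i)"
        by (metis eq_iff_diff_eq_0)
      then show "f dvd u1 i - r * v i"
        by (intro fg[of "u1 i - r * v i"] dvdI)
    qed
  qed
  define x where "x i = (u1 i - r * v i) div f" for i
  have x: "f * x i = u1 i - r * v i" if "i < n" for i
    using r[OF that] by (simp add: x_def)
  have "(\<Sum>j<n. A i j * x j) = w i" if "i < n" for i
  proof -
    have "f * (\<Sum>j<n. A i j * x j) = (\<Sum>j<n. A i j * (f * x j))"
      by (simp add: sum_distrib_left mult.left_commute)
    also have "\<dots> = (\<Sum>j<n. A i j * (u1 j - r * v j))"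
      using x by simp
    also have "\<dots> = (\<Sum>j<n. A i j * u1 j) - r * (\<Sum>j<n. A i j * v j)"
      by (simp add: right_diff_distrib sum_subtractf sum_distrib_left mult.left_commute)
    also have "\<dots> = f * w i"
      using u1 vZ that by simp
    finally show ?thesis
      using f0 by simp
  qed
  then show ?thesis
    by blast
qed


section \<open>Monic polynomials and Laurent polynomials\<close>


text \<open>A monic polynomial is a nonzerodivisor modulo every ideal \<open>J\<close> of the ring of coefficients.
  Applied to \<open>J = (f)\<close> and \<open>J = (f, g)\<close>, this makes monic polynomials in separate variables a regular
  sequence.\<close>

lemma coeffs_in_ideal_of_monic_multiple:
  fixes h c :: "'a::comm_ring_1 poly"
  assumes add: "\<And>x y. x \<in> J \<Longrightarrow> y \<in> J \<Longrightarrow> x - y \<in> J" and zero: "0 \<in> J"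
    and mult: "\<And>r x. x \<in> J \<Longrightarrow> r * x \<in> J"
    and monic: "lead_coeff h = 1" and hc: "\<And>i. coeff (h * c) i \<in> J"
  shows "coeff c i \<in> J"
proof -
  have add': "x + y \<in> J" if "x \<in> J" "y \<in> J" for x y
    using add[OF that(1) mult[OF that(2), of "-1"]] by simp
  have sums: "sum x A \<in> J" if "\<And>k. k \<in> A \<Longrightarrow> x k \<in> J" for A :: "nat set" and x
    using that by (induction A rule: infinite_finite_induct) (auto intro: zero add')
  define d where "d = degree h"
  have "\<forall>i\<ge>N. coeff c i \<in> J" if "\<forall>i\<ge>N + k. coeff c i \<in> J" for N k
    using that
  proof (induction k)
    case (Suc k)
    let ?m = "N + k"
    \<comment> \<open>the coefficient of \<open>h * c\<close> in degree \<open>d + m\<close> is \<open>coeff c m\<close> plus multiples of higher ones\<close>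
    have "coeff (h * c) (d + ?m) = (\<Sum>j\<le>d + ?m. coeff h j * coeff c (d + ?m - j))"
      by (simp add: coeff_mult)
    also have "\<dots> = coeff h d * coeff c ?m + (\<Sum>j\<in>{..d + ?m} - {d}. coeff h j * coeff c (d + ?m - j))"
      by (subst sum.remove[of _ d]) auto
    finally have eq: "coeff c ?m = coeff (h * c) (d + ?m) - (\<Sum>j\<in>{..d + ?m} - {d}. coeff h j * coeff c (d + ?m - j))"
      using monic by (simp add: d_def)
    have "coeff h j * coeff c (d + ?m - j) \<in> J" if "j \<in> {..d + ?m} - {d}" for j
    proof (cases "j < d")
      case True
      then show ?thesis
        using Suc.prems by (intro mult) auto
    next
      case False
      then have "coeff h j = 0"
        using that by (intro coeff_eq_0) (auto simp: d_def)
      then show ?thesis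
        using zero by simp
    qed
    then have "coeff c ?m \<in> J"
      unfolding eq using hc by (intro add sums) auto
    then have "\<forall>i\<ge>N + k. coeff c i \<in> J"
      using Suc.prems by (metis add_Suc_right le_antisym not_less_eq_eq)
    then show ?case
      by (rule Suc.IH)
  qed simp
  moreover have "\<forall>i\<ge>0 + Suc (degree c). coeff c i \<in> J"
    using zero by (auto simp: coeff_eq_0)
  ultimately show ?thesis
    by blast
qed

lemma const_dvd_of_dvd_monic_mult:
  fixes f :: "'a::idom"
  assumes "lead_coeff g = 1" "[:f:] dvd g * x"
  shows "[:f:] dvd x"
proof -
  have "coeff x i \<in> {r. f dvd r}" for i
  proof (rule coeffs_in_ideal_of_monic_multiple[OF _ _ _ assms(1)])
    show "coeff (g * x) i \<in> {r. f dvd r}" for i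
      using assms(2) unfolding const_poly_dvd_iff by simp
  qed auto
  then show ?thesis
    by (simp add: const_poly_dvd_iff)
qed

lemma const_ideal_of_monic_mult:
  fixes f g :: "'a::comm_ring_1"
  assumes "lead_coeff h = 1" "h * x = [:g:] * r + [:f:] * s"
  shows "\<exists>r s. x = [:g:] * r + [:f:] * s"
proof -
  define J where "J = {g * r + f * s | r s. True}"
  have "coeff x i \<in> J" for i
  proof (rule coeffs_in_ideal_of_monic_multiple[OF _ _ _ assms(1)])
    show "a - b \<in> J" if "a \<in> J" "b \<in> J" for a b
    proof -
      from that obtain r s r' s' where "a = g * r + f * s" "b = g * r' + f * s'"
        by (auto simp: J_def)
      then have "a - b = g * (r - r') + f * (s - s')"
        by (simp add: algebra_simps)
      then show ?thesis
        by (auto simp: J_def)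
    qed
    show "0 \<in> J"
      unfolding J_def by (rule CollectI, intro exI[of _ 0]) simp
    show "c * a \<in> J" if "a \<in> J" for a c
    proof -
      from that obtain r s where "a = g * r + f * s"
        by (auto simp: J_def)
      then have "c * a = g * (c * r) + f * (c * s)"
        by (simp add: algebra_simps)
      then show ?thesis
        by (auto simp: J_def)
    qed
    show "coeff (h * x) i \<in> J" for i
      by (auto simp: assms(2) J_def)
  qed
  then have "\<forall>i. \<exists>r s. coeff x i = g * r + f * s"
    by (auto simp: J_def)
  then obtain r' s' where rs: "\<And>i. coeff x i = g * r' i + f * s' i"
    by metis
  let ?r = "\<Sum>i\<le>degree x. monom (r' i) i" and ?s = "\<Sum>i\<le>degree x. monom (s' i) i"
  have "x = [:g:] * ?r + [:f:] * ?s"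
  proof (rule poly_eqI)
    show "coeff x i = coeff ([:g:] * ?r + [:f:] * ?s) i" for i
      using coeff_eq_0[of x i] rs[of i] by (cases "i \<le> degree x") (auto simp: coeff_sum)
  qed
  then show ?thesis
    by blast
qed


lemma poly_mapping_single_add_induct [case_names single add]:
  fixes q :: "'k \<Rightarrow>\<^sub>0 'v::comm_monoid_add"
  assumes single: "\<And>k v. P (Poly_Mapping.single k v)"
    and add: "\<And>q r. P q \<Longrightarrow> P r \<Longrightarrow> P (q + r)"
  shows "P q"
proof -
  have "P (\<Sum>k\<in>K. Poly_Mapping.single k (Poly_Mapping.lookup q k))" for K
    by (induction K rule: infinite_finite_induct) (auto intro: assms single[of _ 0, simplified])
  moreover have "q = (\<Sum>k\<in>Poly_Mapping.keys q. Poly_Mapping.single k (Poly_Mapping.lookup q k))"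
    by (rule poly_mapping_eqI) (auto simp: lookup_sum lookup_single when_def in_keys_iff)
  ultimately show ?thesis
    by metis
qed

text \<open>The last clause says that every element of the target becomes an element of the image when
  multiplied by a unit from the image.\<close>

definition is_localization :: "('a::comm_ring_1 \<Rightarrow> 'b::comm_ring_1) \<Rightarrow> bool" where
  "is_localization h \<longleftrightarrow> inj h \<and> h 0 = 0 \<and> h 1 = 1 \<and> (\<forall>x y. h (x + y) = h x + h y) \<and>
     (\<forall>x y. h (x * y) = h x * h y) \<and> (\<forall>q. \<exists>m p. h m dvd 1 \<and> h m * q = h p)"

lemma is_localization_id: "is_localization id"
  by (auto simp: is_localization_def intro: exI[of _ 1])

text \<open>The ring homomorphism from \<open>A[X]\<close> to \<open>B[X, X\<^sup>-\<^sup>1]\<close> induced by \<open>h\<close>. The Laurent polynomial ring is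
  represented by the finitely supported functions on \<open>\<int>\<close> under convolution.\<close>

definition laurent :: "('a::comm_ring_1 \<Rightarrow> 'b::comm_ring_1) \<Rightarrow> 'a poly \<Rightarrow> (int \<Rightarrow>\<^sub>0 'b)" where
  "laurent h p = (\<Sum>i\<le>degree p. Poly_Mapping.single (int i) (h (coeff p i)))"

context
  fixes h :: "'a::comm_ring_1 \<Rightarrow> 'b::comm_ring_1"
  assumes h: "is_localization h"
begin

lemma localization_hom: "h 0 = 0" "h 1 = 1" "h (x + y) = h x + h y" "h (x * y) = h x * h y"
  using h unfolding is_localization_def by auto

lemma lookup_laurent:
  "Poly_Mapping.lookup (laurent h p) k = (if k \<ge> 0 then h (coeff p (nat k)) else 0)"
proof -
  have "Poly_Mapping.lookup (laurent h p) k =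
      (\<Sum>i\<le>degree p. if int i = k then h (coeff p i) else 0)"
    by (simp add: laurent_def lookup_sum lookup_single when_def)
  also have "\<dots> = (\<Sum>i\<le>degree p. if i = nat k then if k \<ge> 0 then h (coeff p i) else 0 else 0)"
    by (rule sum.cong) auto
  also have "\<dots> = (if k \<ge> 0 then h (coeff p (nat k)) else 0)"
    by (auto simp: localization_hom coeff_eq_0)
  finally show ?thesis .
qed

lemma laurent_add: "laurent h (p + q) = laurent h p + laurent h q"
  by (rule poly_mapping_eqI) (simp add: lookup_laurent lookup_add localization_hom)

lemma laurent_const: "laurent h [:a:] = Poly_Mapping.single 0 (h a)"
  by (simp add: laurent_def)

lemma laurent_pCons: "laurent h (pCons a p) = Poly_Mapping.single 0 (h a) + Poly_Mapping.single 1 1 * laurent h p"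
proof (cases "p = 0")
  case False
  then have "laurent h (pCons a p) = Poly_Mapping.single 0 (h a) + (\<Sum>i\<le>degree p. Poly_Mapping.single (int (Suc i)) (h (coeff p i)))"
    by (simp add: laurent_def sum.atMost_Suc_shift del: sum.atMost_Suc)
  then show ?thesis
    by (simp add: laurent_def sum_distrib_left mult_single)
qed (simp add: laurent_const[of 0, simplified] localization_hom laurent_const)

lemma laurent_smult: "laurent h (Polynomial.smult a p) = Poly_Mapping.single 0 (h a) * laurent h p"
proof (induction p)
  case 0
  then show ?case
    by (simp add: laurent_const[of 0, simplified] localization_hom)
next
  case (pCons b p)
  then show ?case
    by (simp add: laurent_pCons localization_hom mult_single distrib_left mult.left_commute)
qed

lemma laurent_mult: "laurent h (p * q) = laurent h p * laurent h q"
proof (induction p)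
  case 0
  then show ?case
    by (simp add: laurent_const[of 0, simplified] localization_hom)
next
  case (pCons b p)
  then show ?case
    by (simp add: laurent_pCons laurent_add laurent_smult localization_hom distrib_right mult.assoc)
qed

text \<open>A single term \<open>v X\<^sup>k\<close> is cleared by a denominator of \<open>v\<close> times \<open>X\<^sup>e\<close>, where \<open>e = max 0 (- k)\<close>;
  a sum is cleared by the product of denominators of the summands.\<close>

lemma laurent_denominator: "\<exists>m p. laurent h m dvd 1 \<and> laurent h m * q = laurent h p"
proof (induction q rule: poly_mapping_single_add_induct)
  case (single k v)
  obtain m p where mp: "h m dvd 1" "h m * v = h p"
    using h unfolding is_localization_def by blast
  obtain m' where m': "h m * m' = 1"
    using mp(1) by (auto elim: dvdE)
  let ?e = "nat (- k)"
  let ?M = "monom m ?e"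
  have mon: "laurent h (monom c i) = Poly_Mapping.single (int i) (h c)" for c i
    by (rule poly_mapping_eqI) (auto simp: lookup_laurent lookup_single when_def localization_hom)
  have "laurent h ?M * Poly_Mapping.single (- int ?e) m' = 1"
    using m' by (simp add: mon mult_single)
  then have "laurent h ?M dvd 1"
    by (metis dvdI)
  moreover have "laurent h ?M * Poly_Mapping.single k v = laurent h (monom p (nat (int ?e + k)))"
    using mp by (simp add: mon mult_single)
  ultimately show ?case
    by blast
next
  case (add q r)
  then obtain m p m' p' where m: "laurent h m dvd 1" "laurent h m * q = laurent h p"
    and m': "laurent h m' dvd 1" "laurent h m' * r = laurent h p'"
    by blast
  have "laurent h (m * m') dvd 1"
    using m m' by (simp add: laurent_mult is_unit_mult_iff)
  moreover have "laurent h (m * m') * (q + r) =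
      laurent h m' * (laurent h m * q) + laurent h m * (laurent h m' * r)"
    by (simp add: laurent_mult algebra_simps)
  then have "laurent h (m * m') * (q + r) = laurent h (m' * p + m * p')"
    by (simp add: m m' laurent_mult laurent_add)
  ultimately have "laurent h (m * m') dvd 1 \<and> laurent h (m * m') * (q + r) = laurent h (m' * p + m * p')"
    by blast
  then show ?case
    by blast
qed

lemma is_localization_laurent: "is_localization (laurent h)"
proof -
  have "inj (laurent h)"
  proof (rule injI)
    fix p q assume eq: "laurent h p = laurent h q"
    have "h (coeff p n) = h (coeff q n)" for n
      using arg_cong[OF eq, of "\<lambda>c. Poly_Mapping.lookup c (int n)"] by (simp add: lookup_laurent)
    then show "p = q"
      using h by (auto simp: is_localization_def poly_eq_iff dest: injD)
  qed
  moreover have "laurent h 1 = 1"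
    using laurent_const[of 1] by (simp add: localization_hom one_pCons)
  ultimately show ?thesis
    using laurent_denominator laurent_const[of 0]
    by (simp add: is_localization_def laurent_add laurent_mult localization_hom)
qed

end

lemma localization_common_denominator:
  assumes h: "is_localization h" and "finite Q"
  shows "\<exists>m. h m dvd 1 \<and> (\<forall>q\<in>Q. \<exists>p. h m * q = h p)"
  using assms(2)
proof (induction Q)
  case empty
  show ?case
    using localization_hom[OF h] by (intro exI[of _ 1]) simp
next
  case (insert q Q)
  then obtain m where m: "h m dvd 1" "\<forall>q\<in>Q. \<exists>p. h m * q = h p"
    by blast
  obtain m' p where m': "h m' dvd 1" "h m' * q = h p"
    using h unfolding is_localization_def by blast
  have "h (m * m') * q = h (m * p)"
    using m' by (simp add: localization_hom[OF h] mult.assoc)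
  moreover have "\<exists>p. h (m * m') * r = h p" if r: "r \<in> Q" for r
  proof -
    obtain p where "h m * r = h p"
      using m(2) r by blast
    moreover have "h (m * m') * r = h m' * (h m * r)"
      by (simp add: localization_hom[OF h] mult.assoc mult.left_commute)
    ultimately have "h (m * m') * r = h (m' * p)"
      by (simp only: localization_hom[OF h])
    then show ?thesis ..
  qed
  moreover have "h (m * m') dvd 1"
    using m m' by (simp add: localization_hom[OF h] is_unit_mult_iff)
  ultimately show ?case
    by blast
qed


lemma localization_minus:
  assumes "is_localization h"
  shows "h (- x) = - h x" "h (x - y) = h x - h y"
proof -
  have "h (- x) + h x = 0" for x
    by (simp add: localization_hom[OF assms, symmetric])
  then show *: "h (- x) = - h x" for x
    by (simp add: eq_neg_iff_add_eq_0)
  show "h (x - y) = h x - h y"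
    using localization_hom(3)[OF assms, of x "- y"] by (simp add: *)
qed

lemma localization_power:
  assumes "is_localization h"
  shows "h (x ^ k) = h x ^ k"
  by (induction k) (simp_all add: localization_hom[OF assms])

lemma localization_sum:
  assumes "is_localization h"
  shows "h (sum f A) = (\<Sum>x\<in>A. h (f x))"
  by (induction A rule: infinite_finite_induct) (simp_all add: localization_hom[OF assms])

text \<open>The statement only involves finitely many ring elements, and a common denominator moves all
  of them into the factorial ring. It multiplies \<open>A\<close> once, but has to multiply \<open>b\<close> and \<open>w\<close>
  twice, since they are compared with products of two cleared elements, \<open>A i j\<close> and a coefficient.\<close>

lemma image_of_square_matrix_saturated_localization:
  fixes loc :: "'a::factorial_ring_gcd \<Rightarrow> 'b::comm_ring_1" and A :: "nat \<Rightarrow> nat \<Rightarrow> 'b"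
  assumes loc: "is_localization loc"
    and f0: "f \<noteq> 0" and p: "p < n" "b p \<noteq> 0"
    and fg: "\<And>x. f dvd g * x \<Longrightarrow> f dvd x"
    and fgh: "\<And>x. \<exists>r s. h * x = g * r + f * s \<Longrightarrow> \<exists>r s. x = g * r + f * s"
    and rank: "\<And>q. q < n \<Longrightarrow> q \<noteq> p \<Longrightarrow> \<exists>t. \<forall>i<n.
      (\<Sum>j<n. A i j * t j) = loc f * (if i = q then b p else if i = p then - b q else 0)"
    and w: "\<And>e. e \<in> {f, g, h} \<Longrightarrow> \<exists>u. \<forall>i<n. (\<Sum>j<n. A i j * u j) = loc e * w i"
  shows "\<exists>u. \<forall>i<n. (\<Sum>j<n. A i j * u j) = w i"
proof -
  note hom = localization_hom[OF loc] localization_minus[OF loc] localization_sum[OF loc]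
  have inj: "loc x = loc y \<longleftrightarrow> x = y" for x y
    using loc unfolding is_localization_def by (auto dest: injD)
  define good where "good q t \<longleftrightarrow> (\<forall>i<n. (\<Sum>j<n. A i j * t j) =
      loc f * (if i = q then b p else if i = p then - b q else 0))" for q t
  have "\<forall>q\<in>{..<n} - {p}. \<exists>t. good q t"
    using rank by (auto simp: good_def)
  from bchoice[OF this] obtain t where "\<forall>q\<in>{..<n} - {p}. good q (t q)" ..
  then have t: "(\<Sum>j<n. A i j * t q j) = loc f * (if i = q then b p else if i = p then - b q else 0)"
    if "q < n" "q \<noteq> p" "i < n" for q i
    using that by (simp add: good_def)
  have "\<forall>e\<in>{f, g, h}. \<exists>u. \<forall>i<n. (\<Sum>j<n. A i j * u j) = loc e * w i"
    using w by blast
  from bchoice[OF this] obtain u where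
    u: "\<forall>e\<in>{f, g, h}. \<forall>i<n. (\<Sum>j<n. A i j * u e j) = loc e * w i" ..
  define Q where "Q = (\<Union>i<n. \<Union>j<n. {A i j, t i j}) \<union> (\<Union>i<n. {b i, w i}) \<union>
    (\<Union>e\<in>{f, g, h}. \<Union>j<n. {u e j})"
  have "finite Q"
    by (simp add: Q_def)
  from localization_common_denominator[OF loc this]
  obtain m where m: "loc m dvd 1" and "\<forall>q\<in>Q. \<exists>p. loc m * q = loc p"
    by blast
  from bchoice[OF this(2)] obtain c where c: "\<forall>q\<in>Q. loc m * q = loc (c q)" ..
  obtain m' where m': "1 = loc m * m'"
    using m ..
  have cancel: "loc m * x = loc m * y \<longleftrightarrow> x = y" for x y
    by (metis m' mult.assoc mult.commute mult_1)
  have cA: "loc (c (A i j)) = loc m * A i j" if "i < n" "j < n" for i j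
    using that by (intro c[rule_format, symmetric]) (auto simp: Q_def)
  have cb: "loc (c (b i)) = loc m * b i" if "i < n" for i
    using that by (intro c[rule_format, symmetric]) (auto simp: Q_def)
  have cw: "loc (c (w i)) = loc m * w i" if "i < n" for i
    using that by (intro c[rule_format, symmetric]) (auto simp: Q_def)
  have ct: "loc (c (t q j)) = loc m * t q j" if "q < n" "j < n" for q j
    using that by (intro c[rule_format, symmetric]) (auto simp: Q_def)
  have cu: "loc (c (u e j)) = loc m * u e j" if "e \<in> {f, g, h}" "j < n" for e j
    using that by (intro c[rule_format, symmetric]) (auto simp: Q_def)
  have prod: "loc (\<Sum>j<n. c (A i j) * y j) = loc m * (loc m * z)"
    if "i < n" "\<And>j. j < n \<Longrightarrow> loc (y j) = loc m * x j" "(\<Sum>j<n. A i j * x j) = z" for i x y z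
  proof -
    have "loc (\<Sum>j<n. c (A i j) * y j) = (\<Sum>j<n. loc m * (loc m * (A i j * x j)))"
      using that cA by (auto simp: hom intro!: sum.cong)
    then show ?thesis
      unfolding that(3)[symmetric] by (simp add: sum_distrib_left)
  qed
  have "\<exists>v. \<forall>i<n. (\<Sum>j<n. c (A i j) * v j) = m * c (w i)"
  proof (rule image_of_square_matrix_saturated[where b = "\<lambda>i. m * c (b i)" and p = p and f = f and g = g and h = h])
    show "m * c (b p) \<noteq> 0"
    proof
      assume "m * c (b p) = 0"
      then have "loc (m * c (b p)) = loc 0"
        by (simp only:)
      then have "loc m * loc (c (b p)) = 0"
        by (simp only: hom(1,4))
      then have "loc m * (loc m * b p) = loc m * (loc m * 0)"
        using cb[OF p(1)] by simp
      then have "b p = 0"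
        by (simp only: cancel)
      then show False
        using p by simp
    qed
    show "\<exists>v. \<forall>i<n. (\<Sum>j<n. c (A i j) * v j) =
        f * (if i = q then m * c (b p) else if i = p then - (m * c (b q)) else 0)"
      if q: "q < n" "q \<noteq> p" for q
    proof (intro exI[of _ "\<lambda>j. c (t q j)"] allI impI)
      fix i assume i: "i < n"
      have "loc (\<Sum>j<n. c (A i j) * c (t q j)) = loc m * (loc m *
          (loc f * (if i = q then b p else if i = p then - b q else 0)))"
        using i q ct t by (intro prod[where x = "t q"]) auto
      also have "\<dots> = loc (f * (if i = q then m * c (b p) else if i = p then - (m * c (b q)) else 0))"
        using cb p q by (simp add: hom mult.left_commute)
      finally show "(\<Sum>j<n. c (A i j) * c (t q j)) =
          f * (if i = q then m * c (b p) else if i = p then - (m * c (b q)) else 0)"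
        by (simp only: inj)
    qed
    show "\<exists>v. \<forall>i<n. (\<Sum>j<n. c (A i j) * v j) = e * (m * c (w i))" if e: "e \<in> {f, g, h}" for e
    proof (intro exI[of _ "\<lambda>j. c (u e j)"] allI impI)
      fix i assume i: "i < n"
      have "loc (\<Sum>j<n. c (A i j) * c (u e j)) = loc m * (loc m * (loc e * w i))"
        using i e cu u by (intro prod[where x = "u e"]) auto
      also have "\<dots> = loc (e * (m * c (w i)))"
        using cw[OF i] by (simp add: hom mult.left_commute)
      finally show "(\<Sum>j<n. c (A i j) * c (u e j)) = e * (m * c (w i))"
        by (simp only: inj)
    qed
  qed (fact f0 p(1) fg fgh)+
  then obtain v where v: "\<And>i. i < n \<Longrightarrow> (\<Sum>j<n. c (A i j) * v j) = m * c (w i)"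
    by blast
  have "(\<Sum>j<n. A i j * (m' * loc (v j))) = w i" if i: "i < n" for i
  proof -
    have "loc m * (loc m * w i) = loc (\<Sum>j<n. c (A i j) * v j)"
      using v[OF i] cw[OF i] by (simp add: hom)
    also have "\<dots> = loc m * (loc m * (\<Sum>j<n. A i j * (m' * loc (v j))))"
    proof (rule prod[OF i _ refl])
      show "loc (v j) = loc m * (m' * loc (v j))" for j
        by (metis m' mult.assoc mult_1)
    qed
    finally show ?thesis
      by (simp only: cancel)
  qed
  then show ?thesis
    by (intro exI[of _ "\<lambda>j. m' * loc (v j)"] allI impI)
qed


text \<open>The group ring of \<open>\<int>\<^sup>3\<close>, as iterated Laurent polynomials.\<close>

type_synonym laurent3 = "int \<Rightarrow>\<^sub>0 int \<Rightarrow>\<^sub>0 int \<Rightarrow>\<^sub>0 int"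

definition monomial :: "int \<times> int \<times> int \<Rightarrow> laurent3" where
  "monomial = (\<lambda>(a, b, c). Poly_Mapping.single a (Poly_Mapping.single b (Poly_Mapping.single c 1)))"

definition laurent3_coeff :: "laurent3 \<Rightarrow> int \<times> int \<times> int \<Rightarrow> int" where
  "laurent3_coeff q = (\<lambda>(a, b, c). Poly_Mapping.lookup (Poly_Mapping.lookup (Poly_Mapping.lookup q a) b) c)"

lemma monomial_0: "monomial 0 = 1"
  by (simp add: monomial_def zero_prod_def)

lemma monomial_add: "monomial (s + t) = monomial s * monomial t"
  by (cases s; cases t) (simp add: monomial_def mult_single)

lemma laurent3_coeff_add: "laurent3_coeff (p + q) t = laurent3_coeff p t + laurent3_coeff q t"
  by (cases t) (simp add: laurent3_coeff_def lookup_add)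

lemma laurent3_coeff_monomial: "laurent3_coeff (monomial s) t = (if s = t then 1 else 0)"
  by (cases s; cases t) (simp add: laurent3_coeff_def monomial_def lookup_single when_def)

lemma laurent3_coeff_0: "laurent3_coeff 0 t = 0"
  by (cases t) (simp add: laurent3_coeff_def)

lemma inj_monomial: "monomial s = monomial t \<longleftrightarrow> s = t"
  using laurent3_coeff_monomial[of s t] laurent3_coeff_monomial[of t t] by (auto split: if_splits)

lemma finite_laurent3_coeff: "finite {t. laurent3_coeff q t \<noteq> 0}"
proof (rule finite_subset)
  show "{t. laurent3_coeff q t \<noteq> 0} \<subseteq> (SIGMA a:Poly_Mapping.keys q.
      SIGMA b:Poly_Mapping.keys (Poly_Mapping.lookup q a).
        Poly_Mapping.keys (Poly_Mapping.lookup (Poly_Mapping.lookup q a) b))"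
    by (auto simp: laurent3_coeff_def in_keys_iff)
qed simp

lemma laurent3_induct [case_names monomial diff]:
  assumes monomial: "\<And>t. P (monomial t)" and diff: "\<And>p q. P p \<Longrightarrow> P q \<Longrightarrow> P (p - q)"
  shows "P q"
proof -
  have zero: "P 0"
    using diff[OF monomial[of 0] monomial[of 0]] by simp
  have add: "P (p + q)" if "P p" "P q" for p q
    using diff[OF that(1) diff[OF zero that(2)]] by simp
  have int: "P (Poly_Mapping.single a (Poly_Mapping.single b (Poly_Mapping.single c k)))" for a b c k
  proof (induction k rule: int_induct[of _ 0])
    case base
    then show ?case
      using zero by simp
  next
    case (step1 k)
    then show ?case
      using add[OF step1(2) monomial[of "(a, b, c)"]] by (simp add: monomial_def single_add)
  next
    case (step2 k)
    then show ?case
      using diff[OF step2(2) monomial[of "(a, b, c)"]] by (simp add: monomial_def single_diff)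
  qed
  have "P (Poly_Mapping.single a (Poly_Mapping.single b p))" for a b p
    by (induction p rule: poly_mapping_single_add_induct) (simp_all add: int single_add add)
  then have "P (Poly_Mapping.single a p)" for a p
    by (induction p rule: poly_mapping_single_add_induct) (simp_all add: single_add add)
  then show ?thesis
    by (induction q rule: poly_mapping_single_add_induct) (simp_all add: add)
qed

definition laurent3_embedding :: "int poly poly poly \<Rightarrow> laurent3" where
  "laurent3_embedding = laurent (laurent (laurent id))"

lemma is_localization_laurent3: "is_localization laurent3_embedding"
  by (simp add: laurent3_embedding_def is_localization_laurent is_localization_id)

lemma laurent_monom_minus_1:
  assumes "is_localization h"
  shows "laurent h (monom 1 a - 1) = Poly_Mapping.single (int a) 1 - 1"
proof -
  have "laurent h (monom 1 a) = Poly_Mapping.single (int a) 1"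
    by (rule poly_mapping_eqI)
       (auto simp: lookup_laurent[OF assms] lookup_single when_def localization_hom[OF assms])
  then show ?thesis
    using is_localization_laurent[OF assms] by (simp add: localization_minus localization_hom)
qed

lemma lead_coeff_monom_minus_1_power:
  assumes "a > 0"
  shows "lead_coeff ((monom 1 a - 1 :: 'a::idom poly) ^ k) = 1"
proof -
  have "degree (monom 1 a - 1 :: 'a poly) = a"
  proof (rule antisym)
    show "degree (monom 1 a - 1 :: 'a poly) \<le> a"
      by (rule degree_diff_le) (simp_all add: degree_monom_le)
    show "a \<le> degree (monom 1 a - 1 :: 'a poly)"
      using assms by (intro le_degree) simp
  qed
  then show ?thesis
    using assms by (simp add: lead_coeff_power)
qed

text \<open>The polynomials \<open>z\<^sup>a - 1\<close>, \<open>y\<^sup>a - 1\<close>, \<open>x\<^sup>a - 1\<close> and their powers are monic in one variable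
  each. With \<open>x\<close> as the outermost variable, \<open>f\<close> is a constant of a constant, \<open>g\<close> is a constant, and \<open>h\<close>
  is monic in \<open>x\<close> itself.\<close>

lemma laurent3_image_of_square_matrix_saturated:
  fixes A :: "nat \<Rightarrow> nat \<Rightarrow> laurent3" and a k :: nat
  defines "E \<equiv> (\<lambda>t. (monomial t - 1) ^ k) ` {(int a, 0, 0), (0, int a, 0), (0, 0, int a)}"
  assumes a: "a > 0" and p: "p < n" "b p \<noteq> 0"
    and rank: "\<And>q e. q < n \<Longrightarrow> q \<noteq> p \<Longrightarrow> e \<in> E \<Longrightarrow> \<exists>t. \<forall>i<n.
      (\<Sum>j<n. A i j * t j) = e * (if i = q then b p else if i = p then - b q else 0)"
    and w: "\<And>e. e \<in> E \<Longrightarrow> \<exists>u. \<forall>i<n. (\<Sum>j<n. A i j * u j) = e * w i"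
  shows "\<exists>u. \<forall>i<n. (\<Sum>j<n. A i j * u j) = w i"
proof -
  note loc = is_localization_laurent3
  define h :: "int poly poly poly" where "h = (monom 1 a - 1) ^ k"
  define g :: "int poly poly" where "g = (monom 1 a - 1) ^ k"
  define f :: "int poly" where "f = (monom 1 a - 1) ^ k"
  have monic: "lead_coeff h = 1" "lead_coeff g = 1" "lead_coeff f = 1"
    using a unfolding f_def g_def h_def by (rule lead_coeff_monom_minus_1_power)+
  have pow: "[:x ^ k:] = [:x:] ^ k" for x :: "'x::comm_ring_1"
    by (simp add: poly_const_pow)
  have loc1: "is_localization (laurent (id :: int \<Rightarrow> int))"
    by (intro is_localization_laurent is_localization_id)
  have loc2: "is_localization (laurent (laurent (id :: int \<Rightarrow> int)))"
    by (intro loc1 is_localization_laurent)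
  have h: "laurent3_embedding h = (monomial (int a, 0, 0) - 1) ^ k"
    unfolding h_def localization_power[OF loc]
    by (simp add: laurent3_embedding_def laurent_monom_minus_1[OF loc2] monomial_def)
  have g: "laurent3_embedding [:g:] = (monomial (0, int a, 0) - 1) ^ k"
    unfolding g_def pow localization_power[OF loc]
    by (simp add: laurent3_embedding_def laurent_const[OF loc2] laurent_monom_minus_1[OF loc1]
        monomial_def single_diff)
  have f: "laurent3_embedding [:[:f:]:] = (monomial (0, 0, int a) - 1) ^ k"
    unfolding f_def pow localization_power[OF loc]
    by (simp add: laurent3_embedding_def laurent_const[OF loc2] laurent_const[OF loc1]
        laurent_monom_minus_1[OF is_localization_id] monomial_def single_diff)
  have E: "E = laurent3_embedding ` {[:[:f:]:], [:g:], h}"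
    by (auto simp: E_def f g h)
  show ?thesis
  proof (rule image_of_square_matrix_saturated_localization[OF loc, where b = b and p = p and f = "[:[:f:]:]" and g = "[:g:]" and h = h])
    show "[:[:f:]:] \<noteq> 0"
      using monic by auto
    show "[:[:f:]:] dvd x" if "[:[:f:]:] dvd [:g:] * x" for x
      using that const_dvd_of_dvd_monic_mult[OF monic(2), of f]
      by (simp add: const_poly_dvd_iff)
    show "\<exists>r s. x = [:g:] * r + [:[:f:]:] * s" if "\<exists>r s. h * x = [:g:] * r + [:[:f:]:] * s" for x
      using that const_ideal_of_monic_mult[OF monic(1)] by blast
  qed (use p rank w in \<open>auto simp: E\<close>)
qed


section \<open>Fox calculus\<close>


primrec word_value :: "('x letter \<Rightarrow> 'r::comm_ring_1) \<Rightarrow> 'x letter list \<Rightarrow> 'r" where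
  "word_value \<xi> [] = 1"
| "word_value \<xi> (p # w) = \<xi> p * word_value \<xi> w"

text \<open>The Fox derivative of a word with respect to the generator \<open>i\<close>, with coefficients pushed
  forward along the homomorphism that sends a letter \<open>p\<close> to \<open>\<xi> p\<close>. An inverse letter contributes
  \<open>- x\<^sup>-\<^sup>1\<close>.\<close>

primrec fox :: "('x letter \<Rightarrow> 'r::comm_ring_1) \<Rightarrow> 'x letter list \<Rightarrow> 'x \<Rightarrow> 'r" where
  "fox \<xi> [] i = 0"
| "fox \<xi> (p # w) i = (if fst p = i then if snd p then 1 else - \<xi> p else 0) + \<xi> p * fox \<xi> w i"

locale fox_calculus =
  fixes X :: "'x set" and \<xi> :: "'x letter \<Rightarrow> 'r::comm_ring_1"
  assumes \<xi>_inverse: "\<xi> p * \<xi> (inv_letter p) = 1"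
begin

abbreviation "F \<equiv> free_group X"

sublocale F: group F
  by (rule group_free_group)

abbreviation val where "val \<equiv> word_value \<xi>"
abbreviation D where "D \<equiv> fox \<xi>"

lemma val_cancel_cons: "val (cancel_cons p w) = \<xi> p * val w"
  by (cases w) (auto simp: mult.assoc[symmetric] \<xi>_inverse)

lemma D_cancel_cons: "D (cancel_cons p w) i = D (p # w) i"
proof (cases w)
  case (Cons q v)
  have "\<xi> p * (\<xi> (inv_letter p) * D v i) = D v i"
    by (simp add: mult.assoc[symmetric] \<xi>_inverse)
  then show ?thesis
    using Cons \<xi>_inverse[of p] by (auto simp: distrib_left inv_letter_def)
qed simp

lemma mult_F: "u \<otimes>\<^bsub>F\<^esub> v = foldr cancel_cons u v"
  by (simp add: free_group_def)

lemma one_F: "\<one>\<^bsub>F\<^esub> = []"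
  by (simp add: free_group_def)

lemma val_mult: "val (u \<otimes>\<^bsub>F\<^esub> v) = val u * val v"
  unfolding mult_F by (induction u) (simp_all add: val_cancel_cons mult.assoc)

text \<open>The product rule holds for the product of the free group, not only for concatenation, as
  the derivative of a cancelling pair of letters vanishes.\<close>

lemma D_mult: "D (u \<otimes>\<^bsub>F\<^esub> v) i = D u i + val u * D v i"
  unfolding mult_F by (induction u) (simp_all add: D_cancel_cons algebra_simps)

lemma val_inv: "u \<in> carrier F \<Longrightarrow> val u * val (inv\<^bsub>F\<^esub> u) = 1"
  using val_mult[of u "inv\<^bsub>F\<^esub> u"] by (simp add: one_F)

lemma D_inv:
  assumes "u \<in> carrier F"
  shows "D (inv\<^bsub>F\<^esub> u) i = - val (inv\<^bsub>F\<^esub> u) * D u i"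
proof -
  have "D (inv\<^bsub>F\<^esub> u) i + val (inv\<^bsub>F\<^esub> u) * D u i = 0"
    using D_mult[of "inv\<^bsub>F\<^esub> u" u i] assms by (simp add: one_F)
  then show ?thesis
    by (simp add: eq_neg_iff_add_eq_0)
qed

lemma val_conj:
  assumes "g \<in> carrier F" "u \<in> carrier F"
  shows "val (g \<otimes>\<^bsub>F\<^esub> u \<otimes>\<^bsub>F\<^esub> inv\<^bsub>F\<^esub> g) = val u"
proof -
  have "val (g \<otimes>\<^bsub>F\<^esub> u \<otimes>\<^bsub>F\<^esub> inv\<^bsub>F\<^esub> g) = (val g * val (inv\<^bsub>F\<^esub> g)) * val u"
    by (simp add: val_mult mult_ac)
  then show ?thesis
    using assms by (simp add: val_inv)
qed

lemma D_conj:
  assumes "g \<in> carrier F" "u \<in> carrier F"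
  shows "D (g \<otimes>\<^bsub>F\<^esub> u \<otimes>\<^bsub>F\<^esub> inv\<^bsub>F\<^esub> g) i = (1 - val u) * D g i + val g * D u i"
proof -
  have "D (g \<otimes>\<^bsub>F\<^esub> u \<otimes>\<^bsub>F\<^esub> inv\<^bsub>F\<^esub> g) i =
      D g i + val g * D u i - (val g * val (inv\<^bsub>F\<^esub> g)) * (val u * D g i)"
    using assms by (simp add: D_mult val_mult D_inv mult_ac)
  then show ?thesis
    using assms by (simp add: val_inv algebra_simps)
qed

text \<open>For \<open>u\<close> of value \<open>1\<close> this gives multiplication by \<open>1 - val v\<close>; for two generators it gives the
  Koszul vectors.\<close>

lemma D_commutator:
  assumes "u \<in> carrier F" "v \<in> carrier F"
  shows "D (u \<otimes>\<^bsub>F\<^esub> v \<otimes>\<^bsub>F\<^esub> inv\<^bsub>F\<^esub> u \<otimes>\<^bsub>F\<^esub> inv\<^bsub>F\<^esub> v) i =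
    (1 - val v) * D u i - (1 - val u) * D v i"
proof -
  have "D (u \<otimes>\<^bsub>F\<^esub> v \<otimes>\<^bsub>F\<^esub> inv\<^bsub>F\<^esub> u \<otimes>\<^bsub>F\<^esub> inv\<^bsub>F\<^esub> v) i =
      (1 - val v) * D u i + val u * D v i - (val v * val (inv\<^bsub>F\<^esub> v)) * D v i"
    using assms by (simp only: D_mult[of _ "inv\<^bsub>F\<^esub> v"] D_conj val_conj F.inv_closed F.m_closed)
      (simp add: D_inv)
  then show ?thesis
    using assms by (simp add: val_inv algebra_simps)
qed

lemma val_commutator:
  assumes "u \<in> carrier F" "v \<in> carrier F"
  shows "val (u \<otimes>\<^bsub>F\<^esub> v \<otimes>\<^bsub>F\<^esub> inv\<^bsub>F\<^esub> u \<otimes>\<^bsub>F\<^esub> inv\<^bsub>F\<^esub> v) = 1"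
  using assms by (simp only: val_mult[of _ "inv\<^bsub>F\<^esub> v"] val_conj val_inv)

definition relation_span :: "nat \<Rightarrow> 'x letter list list \<Rightarrow> ('x \<Rightarrow> 'r) set" where
  "relation_span m rs = {v. \<exists>l. \<forall>i\<in>X. v i = (\<Sum>j<m. D (rs ! j) i * l j)}"

lemma relation_span_add:
  assumes "u \<in> relation_span m rs" "v \<in> relation_span m rs"
  shows "(\<lambda>i. u i + v i) \<in> relation_span m rs"
proof -
  from assms obtain k l where "\<forall>i\<in>X. u i = (\<Sum>j<m. D (rs ! j) i * k j)"
    "\<forall>i\<in>X. v i = (\<Sum>j<m. D (rs ! j) i * l j)"
    by (auto simp: relation_span_def)
  then have "\<forall>i\<in>X. u i + v i = (\<Sum>j<m. D (rs ! j) i * (k j + l j))"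
    by (simp add: distrib_left sum.distrib)
  then show ?thesis
    unfolding relation_span_def by (intro CollectI exI)
qed

lemma relation_span_scale:
  assumes "u \<in> relation_span m rs"
  shows "(\<lambda>i. c * u i) \<in> relation_span m rs"
proof -
  from assms obtain k where "\<forall>i\<in>X. u i = (\<Sum>j<m. D (rs ! j) i * k j)"
    by (auto simp: relation_span_def)
  then have "\<forall>i\<in>X. c * u i = (\<Sum>j<m. D (rs ! j) i * (c * k j))"
    by (simp add: sum_distrib_left mult.left_commute)
  then show ?thesis
    unfolding relation_span_def by (intro CollectI exI)
qed

text \<open>The words of value \<open>1\<close> whose derivative lies in the span form a normal subgroup: on words
  of value \<open>1\<close> the map \<open>D\<close> is additive, and conjugation by \<open>g\<close> multiplies it by \<open>val g\<close>.\<close>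

lemma D_normal_closure:
  assumes rs: "set rs \<subseteq> carrier F" and val: "\<And>r. r \<in> set rs \<Longrightarrow> val r = 1"
    and w: "w \<in> normal_closure F (set rs)"
  shows "D w \<in> relation_span (length rs) rs"
proof -
  let ?N = "relation_span (length rs) rs"
  define S where "S = {u \<in> carrier F. val u = 1 \<and> D u \<in> ?N}"
  have zero: "(\<lambda>i. 0) \<in> ?N"
    unfolding relation_span_def by (rule CollectI, rule exI[of _ "\<lambda>_. 0"]) simp
  have nil: "D [] = (\<lambda>i. 0)"
    by (rule ext) simp
  have "S \<lhd> F"
    unfolding F.normal_inv_iff
  proof (intro conjI ballI)
    show "subgroup S F"
    proof (rule F.subgroupI)
      show "S \<noteq> {}"
        using zero F.one_closed unfolding S_def one_F
        by (intro ex_in_conv[THEN iffD1] exI[of _ "[]"]) (simp add: nil del: fox.simps)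
      show "inv\<^bsub>F\<^esub> a \<in> S" if a: "a \<in> S" for a
      proof -
        have "val (inv\<^bsub>F\<^esub> a) = 1"
          using a val_inv[of a] by (simp add: S_def)
        moreover have "D (inv\<^bsub>F\<^esub> a) = (\<lambda>i. - val (inv\<^bsub>F\<^esub> a) * D a i)"
          using a by (intro ext D_inv) (simp add: S_def)
        ultimately show ?thesis
          using a relation_span_scale[of "D a" _ rs "- val (inv\<^bsub>F\<^esub> a)"] by (simp add: S_def)
      qed
      show "a \<otimes>\<^bsub>F\<^esub> b \<in> S" if ab: "a \<in> S" "b \<in> S" for a b
      proof -
        have "D (a \<otimes>\<^bsub>F\<^esub> b) = (\<lambda>i. D a i + D b i)"
          using ab by (intro ext) (simp add: D_mult S_def)
        then show ?thesis
          using ab relation_span_add[of "D a" _ rs "D b"] by (simp add: S_def val_mult)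
      qed
    qed (auto simp: S_def)
    show "g \<otimes>\<^bsub>F\<^esub> a \<otimes>\<^bsub>F\<^esub> inv\<^bsub>F\<^esub> g \<in> S" if ga: "g \<in> carrier F" "a \<in> S" for g a
    proof -
      have "D (g \<otimes>\<^bsub>F\<^esub> a \<otimes>\<^bsub>F\<^esub> inv\<^bsub>F\<^esub> g) = (\<lambda>i. val g * D a i)"
        using ga by (intro ext) (simp add: D_conj S_def)
      then show ?thesis
        using ga relation_span_scale[of "D a" _ rs "val g"] by (simp add: S_def val_conj)
    qed
  qed
  moreover have "set rs \<subseteq> S"
  proof
    fix r assume r: "r \<in> set rs"
    then obtain j where j: "j < length rs" "r = rs ! j"
      by (metis in_set_conv_nth)
    have "\<forall>i\<in>X. D r i = (\<Sum>k<length rs. D (rs ! k) i * (if k = j then 1 else 0))"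
      using j by (simp add: if_distrib[where f = "\<lambda>x. _ * x"] cong: if_cong)
    then have "D r \<in> ?N"
      unfolding relation_span_def by (intro CollectI exI)
    then show "r \<in> S"
      using r rs val by (auto simp: S_def)
  qed
  ultimately have "normal_closure F (set rs) \<subseteq> S"
    unfolding normal_closure_def by (rule hull_minimal[rotated])
  then show ?thesis
    using w by (auto simp: S_def)
qed

end


section \<open>Iterated commutators\<close>

fun iterated_commutator :: "('a, 'b) monoid_scheme \<Rightarrow> nat \<Rightarrow> 'a \<Rightarrow> 'a \<Rightarrow> 'a" where
  "iterated_commutator G 0 u g = u"
| "iterated_commutator G (Suc k) u g =
    (let w = iterated_commutator G k u g in w \<otimes>\<^bsub>G\<^esub> g \<otimes>\<^bsub>G\<^esub> inv\<^bsub>G\<^esub> w \<otimes>\<^bsub>G\<^esub> inv\<^bsub>G\<^esub> g)"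

lemma (in group) iterated_commutator_closed:
  "u \<in> carrier G \<Longrightarrow> g \<in> carrier G \<Longrightarrow> iterated_commutator G k u g \<in> carrier G"
  by (induction k) (auto simp: Let_def)

lemma (in group) iterated_commutator_in_lower_central_series:
  assumes "u \<in> carrier G" "g \<in> carrier G"
  shows "iterated_commutator G k u g \<in> lower_central_series G k"
proof (induction k)
  case (Suc k)
  then show ?case
    using assms(2) by (auto simp: Let_def commutator_subgroup_def intro!: generate.incl)
qed (simp add: assms)

lemma iterated_commutator_hom:
  assumes "group_hom G H \<pi>" "u \<in> carrier G" "g \<in> carrier G"
  shows "\<pi> (iterated_commutator G k u g) = iterated_commutator H k (\<pi> u) (\<pi> g)"
proof -
  interpret group_hom G H \<pi> by fact
  show ?thesis
    using assms(2,3) by (induction k) (simp_all add: Let_def G.iterated_commutator_closed)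
qed

lemma (in fox_calculus) D_iterated_commutator:
  assumes "u \<in> carrier F" "g \<in> carrier F" "val u = 1"
  shows "D (iterated_commutator F k u g) i = (1 - val g) ^ k * D u i"
    and "val (iterated_commutator F k u g) = 1"
proof -
  have "val (iterated_commutator F k u g) = 1 \<and> (\<forall>i. D (iterated_commutator F k u g) i = (1 - val g) ^ k * D u i)"
  proof (induction k)
    case (Suc k)
    then show ?case
      using assms by (simp only: iterated_commutator.simps Let_def val_commutator D_commutator F.iterated_commutator_closed)
        (simp add: mult.assoc)
  qed (simp add: assms)
  then show "D (iterated_commutator F k u g) i = (1 - val g) ^ k * D u i"
    "val (iterated_commutator F k u g) = 1"
    by auto
qed


section \<open>The abelianisation of the kernel\<close>


lemma free_group_word_induct [consumes 1, case_names Nil Cons]: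
  assumes "w \<in> carrier (free_group X)"
    and "P []"
    and "\<And>p w. fst p \<in> X \<Longrightarrow> w \<in> carrier (free_group X) \<Longrightarrow> P w \<Longrightarrow> P ([p] \<otimes>\<^bsub>free_group X\<^esub> w)"
  shows "P w"
  using assms(1)
proof (induction w)
  case (Cons p w)
  then have p: "fst p \<in> X" and w: "w \<in> carrier (free_group X)"
    by (auto simp: free_group_def reduced_word_Cons)
  have "p # w = [p] \<otimes>\<^bsub>free_group X\<^esub> w"
    using Cons.prems by (cases w) (auto simp: free_group_def reduced_word_Cons)
  then show ?case
    using assms(3)[OF p w Cons.IH[OF w]] by simp
qed (use assms(2) in simp)

lemma singleton_in_free_group: "fst p \<in> X \<Longrightarrow> [p] \<in> carrier (free_group X)"
  by (simp add: free_group_def reduced_word_Cons)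

text \<open>\<open>\<pi>\<close> is the quotient map of a presentation of \<open>G\<close>, and \<open>\<theta>\<close> defines a covering of the
  presentation complex whose deck group is the image of \<open>\<theta>\<close> in \<open>\<int>\<^sup>3\<close>.\<close>

locale presented_cover = group G for G (structure) +
  fixes n :: nat and rs :: "nat letter list list" and \<pi> :: "nat letter list \<Rightarrow> 'a"
    and \<theta> :: "'a \<Rightarrow> int \<times> int \<times> int"
  assumes relators_in_free_group: "set rs \<subseteq> carrier (free_group {..<n})"
    and \<pi>_hom: "\<pi> \<in> hom (free_group {..<n}) G"
    and \<pi>_surj: "\<pi> ` carrier (free_group {..<n}) = carrier G"
    and \<pi>_relator: "\<And>r. r \<in> set rs \<Longrightarrow> \<pi> r = \<one>"
    and \<pi>_kernel: "\<And>w. w \<in> carrier (free_group {..<n}) \<Longrightarrow> \<pi> w = \<one> \<Longrightarrow>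
      w \<in> normal_closure (free_group {..<n}) (set rs)"
    and \<theta>_mult: "\<And>g h. g \<in> carrier G \<Longrightarrow> h \<in> carrier G \<Longrightarrow> \<theta> (g \<otimes> h) = \<theta> g + \<theta> h"
begin

text \<open>The value \<open>1\<close> on letters outside the alphabet keeps the values of \<open>p\<close> and \<open>inv_letter p\<close>
  inverse to each other for every letter \<open>p\<close>.\<close>

definition \<xi> :: "nat letter \<Rightarrow> laurent3" where
  "\<xi> p = (if fst p < n then monomial (\<theta> (\<pi> [p])) else 1)"

lemma \<theta>_one: "\<theta> \<one> = 0"
  using \<theta>_mult[of \<one> \<one>] by simp

lemma \<theta>_inv: "g \<in> carrier G \<Longrightarrow> \<theta> (inv g) = - \<theta> g"
  using \<theta>_mult[of "inv g" g] by (simp add: \<theta>_one eq_neg_iff_add_eq_0)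

interpretation \<pi>: group_hom "free_group {..<n}" G \<pi>
  by (intro group_hom.intro group_hom_axioms.intro group_free_group \<pi>_hom is_group)

lemma \<pi>_Nil: "\<pi> [] = \<one>"
  using \<pi>.hom_one by (simp add: free_group_def)

lemma \<pi>_letter_closed: "fst p < n \<Longrightarrow> \<pi> [p] \<in> carrier G"
  by (simp add: singleton_in_free_group)

lemma \<pi>_inv_letter: "fst p < n \<Longrightarrow> \<pi> [inv_letter p] = inv (\<pi> [p])"
proof -
  assume p: "fst p < n"
  have "[inv_letter p] \<otimes>\<^bsub>free_group {..<n}\<^esub> [p] = []"
    by (simp add: free_group_def)
  then have "\<pi> [inv_letter p] \<otimes> \<pi> [p] = \<one>"
    using p \<pi>.hom_mult[of "[inv_letter p]" "[p]"] by (simp add: singleton_in_free_group \<pi>_Nil)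
  then show "\<pi> [inv_letter p] = inv (\<pi> [p])"
    using p by (simp add: inv_equality[symmetric] \<pi>_letter_closed)
qed

sublocale fox_calculus "{..<n}" \<xi>
proof
  show "\<xi> p * \<xi> (inv_letter p) = 1" for p
    by (simp add: \<xi>_def \<pi>_inv_letter \<theta>_inv \<pi>_letter_closed monomial_add[symmetric] monomial_0)
qed

lemma \<xi>_eq: "fst p < n \<Longrightarrow> \<xi> p = monomial (\<theta> (\<pi> [p]))"
  by (simp add: \<xi>_def)

lemma val_eq: "w \<in> carrier F \<Longrightarrow> val w = monomial (\<theta> (\<pi> w))"
proof (induction w rule: free_group_word_induct)
  case Nil
  then show ?case
    by (simp add: \<pi>_Nil \<theta>_one monomial_0)
next
  case (Cons p w)
  then show ?case
    using \<xi>_eq[of p] by (simp add: val_mult singleton_in_free_group \<theta>_mult monomial_add)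
qed

definition K :: "'a set" where
  "K = {g \<in> carrier G. \<theta> g = 0}"

abbreviation "GK \<equiv> G\<lparr>carrier := K\<rparr>"

lemma subgroup_K: "subgroup K G"
  by (rule subgroupI) (auto simp: K_def \<theta>_inv \<theta>_mult \<theta>_one intro!: exI[of _ \<one>])

sublocale GK: group GK
  by (rule subgroup.subgroup_is_group[OF subgroup_K is_group])

definition "Kab = GK Mod derived GK K"

definition cl :: "'a \<Rightarrow> 'a set" where
  "cl k = derived GK K #>\<^bsub>GK\<^esub> k"

sublocale Kab: comm_group Kab
  using GK.derived_quot_is_comm_group by (simp add: Kab_def)

lemma cl_group_hom: "group_hom GK Kab cl"
proof -
  have "derived GK K \<lhd> GK"
    using GK.derived_self_is_normal by simp
  then have "(\<lambda>k. derived GK K #>\<^bsub>GK\<^esub> k) \<in> hom GK Kab"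
    unfolding Kab_def by (rule normal.r_coset_hom_Mod)
  then show ?thesis
    by (intro group_hom.intro group_hom_axioms.intro GK.is_group Kab.is_group) (simp add: cl_def[abs_def])
qed

sublocale cl: group_hom GK Kab cl
  by (rule cl_group_hom)

lemma cl_eq_oneD: "k \<in> K \<Longrightarrow> cl k = \<one>\<^bsub>Kab\<^esub> \<Longrightarrow> k \<in> derived GK K"
proof -
  assume k: "k \<in> K" and "cl k = \<one>\<^bsub>Kab\<^esub>"
  then have "derived GK K #>\<^bsub>GK\<^esub> k = derived GK K"
    by (simp add: cl_def Kab_def FactGroup_def)
  moreover have "subgroup (derived GK K) GK"
    using GK.derived_is_subgroup[of K] by simp
  ultimately show "k \<in> derived GK K"
    using k GK.coset_join1[of "derived GK K" k] subgroup.subset by fastforce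
qed

text \<open>\<open>rep\<close> picks a representative in each coset of the image of \<open>\<theta>\<close>, which may be a proper
  subgroup of \<open>\<int>\<^sup>3\<close>, and \<open>sec t\<close> is an element of \<open>G\<close> that leads from the representative to \<open>t\<close>.\<close>

definition rep :: "int \<times> int \<times> int \<Rightarrow> int \<times> int \<times> int" where
  "rep t = (SOME r. \<exists>g\<in>carrier G. \<theta> g = t - r)"

definition sec :: "int \<times> int \<times> int \<Rightarrow> 'a" where
  "sec t = (SOME g. g \<in> carrier G \<and> \<theta> g = t - rep t)"

lemma sec: "sec t \<in> carrier G" "\<theta> (sec t) = t - rep t"
proof -
  have "\<exists>g\<in>carrier G. \<theta> g = t - rep t"
    unfolding rep_def by (rule someI[where x = t]) (auto intro!: bexI[of _ \<one>] simp: \<theta>_one)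
  then have "\<exists>g. g \<in> carrier G \<and> \<theta> g = t - rep t"
    by blast
  then have "sec t \<in> carrier G \<and> \<theta> (sec t) = t - rep t"
    unfolding sec_def by (rule someI_ex)
  then show "sec t \<in> carrier G" "\<theta> (sec t) = t - rep t"
    by auto
qed

lemma rep_shift:
  assumes g: "g \<in> carrier G"
  shows "rep (t + \<theta> g) = rep t"
proof -
  have "(\<exists>h\<in>carrier G. \<theta> h = t + \<theta> g - r) \<longleftrightarrow> (\<exists>h\<in>carrier G. \<theta> h = t - r)" for r
  proof
    assume "\<exists>h\<in>carrier G. \<theta> h = t + \<theta> g - r"
    then obtain h where "h \<in> carrier G" "\<theta> h = t + \<theta> g - r" ..
    then show "\<exists>h\<in>carrier G. \<theta> h = t - r"
      using g by (intro bexI[of _ "h \<otimes> inv g"]) (simp_all add: \<theta>_mult \<theta>_inv)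
  next
    assume "\<exists>h\<in>carrier G. \<theta> h = t - r"
    then obtain h where "h \<in> carrier G" "\<theta> h = t - r" ..
    then show "\<exists>h\<in>carrier G. \<theta> h = t + \<theta> g - r"
      using g by (intro bexI[of _ "h \<otimes> g"]) (simp_all add: \<theta>_mult)
  qed
  then show ?thesis
    by (simp add: rep_def)
qed

text \<open>The Reidemeister--Schreier rewriting: the path labelled \<open>g\<close> that starts at \<open>t\<close> is closed up
  by the chosen paths to its ends. Consecutive paths telescope (\<open>lift_mult\<close>).\<close>

definition lift :: "int \<times> int \<times> int \<Rightarrow> 'a \<Rightarrow> 'a" where
  "lift t g = sec t \<otimes> g \<otimes> inv (sec (t + \<theta> g))"

lemma lift_in_K: "g \<in> carrier G \<Longrightarrow> lift t g \<in> K"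
  by (simp add: K_def lift_def sec \<theta>_mult \<theta>_inv rep_shift)

lemma lift_one: "lift t \<one> = \<one>"
  by (simp add: lift_def sec \<theta>_one)

lemma lift_mult:
  assumes "g \<in> carrier G" "h \<in> carrier G"
  shows "lift t (g \<otimes> h) = lift t g \<otimes> lift (t + \<theta> g) h"
proof -
  let ?s = "sec (t + \<theta> g)" and ?r = "inv (sec (t + \<theta> g + \<theta> h))"
  have "inv ?s \<otimes> (?s \<otimes> (h \<otimes> ?r)) = h \<otimes> ?r"
    using assms sec(1) by (simp add: m_assoc[symmetric])
  then have "lift t g \<otimes> lift (t + \<theta> g) h = sec t \<otimes> (g \<otimes> (h \<otimes> ?r))"
    using assms sec(1) by (simp add: lift_def m_assoc)
  also have "\<dots> = lift t (g \<otimes> h)"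
    using assms sec(1) by (simp add: lift_def m_assoc \<theta>_mult add.assoc)
  finally show ?thesis ..
qed

lemma cl_lift_mult:
  assumes "g \<in> carrier G" "h \<in> carrier G"
  shows "cl (lift t (g \<otimes> h)) = cl (lift t g) \<otimes>\<^bsub>Kab\<^esub> cl (lift (t + \<theta> g) h)"
  using assms cl.hom_mult[of "lift t g" "lift (t + \<theta> g) h"] by (simp add: lift_mult lift_in_K)

lemma cl_lift_closed: "g \<in> carrier G \<Longrightarrow> cl (lift t g) \<in> carrier Kab"
  using cl.hom_closed[of "lift t g"] by (simp add: lift_in_K)

lemma cl_one: "cl \<one> = \<one>\<^bsub>Kab\<^esub>"
  using cl.hom_one by simp

text \<open>A vector in \<open>\<Lambda>\<^sup>n\<close> is an integral combination of edges \<open>(t, i)\<close>, the edge labelled by the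
  generator \<open>i\<close> at the vertex \<open>t\<close>. As the edges are a basis of a free abelian group, sending each
  edge to the class of its closed-up loop in the abelianisation of \<open>K\<close> extends to a
  homomorphism.\<close>

lemma edge_homomorphism:
  obtains \<Phi> :: "(nat \<Rightarrow> laurent3) \<Rightarrow> 'a set" where
    "\<And>v. \<Phi> v \<in> carrier Kab"
    "\<And>u v. \<Phi> (\<lambda>i. u i + v i) = \<Phi> u \<otimes>\<^bsub>Kab\<^esub> \<Phi> v"
    "\<And>t i. i < n \<Longrightarrow> \<Phi> (\<lambda>j. if j = i then monomial t else 0) = cl (lift t (\<pi> [(i, True)]))"
    "\<And>u v. (\<And>i. i < n \<Longrightarrow> u i = v i) \<Longrightarrow> \<Phi> u = \<Phi> v"
proof -
  define e where "e = (\<lambda>(t, i). if i < n then cl (lift t (\<pi> [(i, True)])) else \<one>\<^bsub>Kab\<^esub>)"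
  have "e ` UNIV \<subseteq> carrier Kab"
    by (auto simp: e_def cl_lift_closed \<pi>_letter_closed)
  then have "\<exists>h. h \<in> hom (free_Abelian_group UNIV) Kab \<and> (\<forall>x. h (frag_of x) = e x)"
    by (rule Kab.free_Abelian_group_universal) (rule exI, rule conjI, assumption, blast)
  then obtain h where h: "h \<in> hom (free_Abelian_group UNIV) Kab" "\<And>x. h (frag_of x) = e x"
    by blast
  \<comment> \<open>\<open>flat v\<close> lists the coefficients of the vector of Laurent polynomials \<open>v\<close>, indexed by edges\<close>
  define flat where "flat v = Abs_poly_mapping (\<lambda>(t, i). if i < n then laurent3_coeff (v i) t else 0)"
    for v :: "nat \<Rightarrow> laurent3"
  have lookup_flat: "Poly_Mapping.lookup (flat v) (t, i) = (if i < n then laurent3_coeff (v i) t else 0)" for v t i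
  proof -
    have "finite {x. (case x of (t, i) \<Rightarrow> if i < n then laurent3_coeff (v i) t else 0) \<noteq> 0}"
    proof (rule finite_subset)
      show "{x. (case x of (t, i) \<Rightarrow> if i < n then laurent3_coeff (v i) t else 0) \<noteq> 0}
          \<subseteq> (\<Union>i<n. {t. laurent3_coeff (v i) t \<noteq> 0} \<times> {i})"
        by (auto split: if_splits)
    qed (simp add: finite_laurent3_coeff)
    then show ?thesis
      by (simp add: flat_def)
  qed
  show ?thesis
  proof (rule that[of "\<lambda>v. h (flat v)"])
    show "h (flat v) \<in> carrier Kab" for v
      using h(1) by (auto simp: hom_def)
    show "h (flat (\<lambda>i. u i + v i)) = h (flat u) \<otimes>\<^bsub>Kab\<^esub> h (flat v)" for u v
    proof -
      have "flat (\<lambda>i. u i + v i) = flat u + flat v"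
        by (rule poly_mapping_eqI) (auto simp: lookup_flat lookup_add laurent3_coeff_add)
      then show ?thesis
        using hom_mult[OF h(1), of "flat u" "flat v"] by simp
    qed
    show "h (flat (\<lambda>j. if j = i then monomial t else 0)) = cl (lift t (\<pi> [(i, True)]))" if "i < n" for t i
    proof -
      have "flat (\<lambda>j. if j = i then monomial t else 0) = frag_of (t, i)"
        using that by (intro poly_mapping_eqI)
          (auto simp: lookup_flat lookup_single when_def laurent3_coeff_monomial laurent3_coeff_0 split: if_splits)
      then show ?thesis
        using that by (simp add: h(2) e_def)
    qed
    show "h (flat u) = h (flat v)" if "\<And>i. i < n \<Longrightarrow> u i = v i" for u v
    proof -
      have "flat u = flat v"
        using that by (intro poly_mapping_eqI) (auto simp: lookup_flat)
      then show ?thesis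
        by simp
    qed
  qed
qed

text \<open>The homomorphism \<open>\<Phi>\<close> on edges sends the chain \<open>D w\<close>, translated to \<open>t\<close>, to the class of the loop
  \<open>lift t (\<pi> w)\<close>. It kills every translate of \<open>D r\<close> for a relator \<open>r\<close>, since \<open>\<pi> r\<close> is trivial, and so it
  kills the span of these translates.\<close>

lemma relation_span_imp_derived:
  assumes w: "w \<in> carrier F" "\<pi> w \<in> K" and span: "D w \<in> relation_span (length rs) rs"
  shows "lift 0 (\<pi> w) \<in> derived GK K"
proof -
  obtain \<Phi> :: "(nat \<Rightarrow> laurent3) \<Rightarrow> 'a set" where
    closed: "\<And>v. \<Phi> v \<in> carrier Kab" and
    add: "\<And>u v. \<Phi> (\<lambda>i. u i + v i) = \<Phi> u \<otimes>\<^bsub>Kab\<^esub> \<Phi> v" and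
    edge: "\<And>t i. i < n \<Longrightarrow> \<Phi> (\<lambda>j. if j = i then monomial t else 0) = cl (lift t (\<pi> [(i, True)]))" and
    cong: "\<And>u v. (\<And>i. i < n \<Longrightarrow> u i = v i) \<Longrightarrow> \<Phi> u = \<Phi> v"
    using edge_homomorphism by blast
  have zero: "\<Phi> (\<lambda>i. 0) = \<one>\<^bsub>Kab\<^esub>"
    using add[of "\<lambda>i. 0" "\<lambda>i. 0"] closed[of "\<lambda>i. 0"] by simp
  have diff_one: "\<Phi> (\<lambda>i. u i - v i) = \<one>\<^bsub>Kab\<^esub>" if "\<Phi> u = \<one>\<^bsub>Kab\<^esub>" "\<Phi> v = \<one>\<^bsub>Kab\<^esub>" for u v
    using add[of "\<lambda>i. u i - v i" v] that closed by simp
  \<comment> \<open>a positive letter is an edge; an inverse letter is the edge that ends where it starts, run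
    through backwards\<close>
  have letter: "\<Phi> (\<lambda>i. monomial t * D [p] i) = cl (lift t (\<pi> [p]))" if p: "fst p < n" for t p
  proof (cases "snd p")
    case True
    then have "\<Phi> (\<lambda>i. monomial t * D [p] i) = \<Phi> (\<lambda>j. if j = fst p then monomial t else 0)"
      by (intro cong) auto
    also have "\<dots> = cl (lift t (\<pi> [p]))"
      using edge[OF p, of t] True by (cases p) simp
    finally show ?thesis .
  next
    case False
    let ?x = "\<pi> [inv_letter p]" and ?s = "t + \<theta> (\<pi> [p])"
    have x: "inv_letter p = (fst p, True)"
      using False by (simp add: inv_letter_def)
    have x_closed: "?x \<in> carrier G"
      using p by (intro \<pi>_letter_closed) simp
    have inv: "\<pi> [p] = inv ?x"
      using p \<pi>_letter_closed[OF p] by (simp add: \<pi>_inv_letter)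
    let ?u = "\<lambda>j. if j = fst p then monomial ?s else 0"
    have "\<Phi> (\<lambda>i. monomial t * D [p] i) \<otimes>\<^bsub>Kab\<^esub> \<Phi> ?u = \<Phi> (\<lambda>i. monomial t * D [p] i + ?u i)"
      by (rule add[symmetric])
    also have "\<dots> = \<Phi> (\<lambda>i. 0)"
      using p False by (intro cong) (auto simp: \<xi>_def monomial_add)
    also have "\<dots> = cl (lift t (inv ?x \<otimes> ?x))"
      using x_closed by (simp add: zero lift_one cl_one)
    also have "\<dots> = cl (lift t (\<pi> [p])) \<otimes>\<^bsub>Kab\<^esub> cl (lift ?s ?x)"
      unfolding inv[symmetric] using x_closed \<pi>_letter_closed[OF p] by (rule cl_lift_mult[rotated])
    also have "cl (lift ?s ?x) = \<Phi> ?u"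
      unfolding x by (rule edge[OF p, symmetric])
    finally show ?thesis
      using closed cl_lift_closed \<pi>_letter_closed[OF p] by simp
  qed
  have path: "\<Phi> (\<lambda>i. monomial t * D u i) = cl (lift t (\<pi> u))" if "u \<in> carrier F" for u t
    using that
  proof (induction u arbitrary: t rule: free_group_word_induct)
    case Nil
    then show ?case
      by (simp add: zero \<pi>_Nil lift_one cl_one)
  next
    case (Cons p u)
    then have p: "fst p < n" and u: "u \<in> carrier F" and pF: "[p] \<in> carrier F"
      by (auto simp: singleton_in_free_group)
    have "\<Phi> (\<lambda>i. monomial t * D ([p] \<otimes>\<^bsub>F\<^esub> u) i) =
        \<Phi> (\<lambda>i. monomial t * D [p] i + monomial (t + \<theta> (\<pi> [p])) * D u i)"
      using p by (intro cong) (simp add: D_mult \<xi>_def monomial_add distrib_left mult.assoc del: fox.simps)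
    also have "\<dots> = cl (lift t (\<pi> [p])) \<otimes>\<^bsub>Kab\<^esub> cl (lift (t + \<theta> (\<pi> [p])) (\<pi> u))"
      unfolding add by (simp only: letter[OF p] Cons.IH)
    also have "\<dots> = cl (lift t (\<pi> ([p] \<otimes>\<^bsub>F\<^esub> u)))"
      using u pF by (simp add: cl_lift_mult)
    finally show ?case .
  qed
  have relator: "\<Phi> (\<lambda>i. q * D r i) = \<one>\<^bsub>Kab\<^esub>" if r: "r \<in> set rs" for q r
  proof (induction q rule: laurent3_induct)
    case (monomial t)
    have "r \<in> carrier F"
      using r relators_in_free_group by blast
    then show ?case
      using path[of r t] \<pi>_relator[OF r] by (simp add: lift_one cl_one)
  next
    case (diff p q)
    then show ?case
      using diff_one[of "\<lambda>i. p * D r i" "\<lambda>i. q * D r i"] by (simp add: left_diff_distrib)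
  qed
  obtain l where l: "\<forall>i\<in>{..<n}. D w i = (\<Sum>j<length rs. D (rs ! j) i * l j)"
    using span by (auto simp: relation_span_def)
  have "\<Phi> (\<lambda>i. \<Sum>j<m. D (rs ! j) i * l j) = \<one>\<^bsub>Kab\<^esub>" if "m \<le> length rs" for m
    using that
  proof (induction m)
    case (Suc m)
    then show ?case
      using relator[of "rs ! m" "l m"] add[of "\<lambda>i. \<Sum>j<m. D (rs ! j) i * l j" "\<lambda>i. D (rs ! m) i * l m"]
      by (simp add: mult.commute)
  qed (simp add: zero)
  from this[of "length rs"] have "\<one>\<^bsub>Kab\<^esub> = \<Phi> (\<lambda>i. monomial 0 * D w i)"
    using l by (simp add: monomial_0) (metis (mono_tags, lifting) cong lessThan_iff)
  also have "\<dots> = cl (lift 0 (\<pi> w))"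
    by (rule path[OF w(1)])
  finally have "cl (lift 0 (\<pi> w)) = \<one>\<^bsub>Kab\<^esub>" ..
  moreover have "lift 0 (\<pi> w) \<in> K"
    using w(2) by (intro lift_in_K) (simp add: K_def)
  ultimately show ?thesis
    by (rule cl_eq_oneD[rotated])
qed

end


section \<open>The kernel of a nilpotent cover\<close>


lemma (in presented_cover) obtain_word:
  assumes "g \<in> carrier G"
  obtains v where "v \<in> carrier F" "\<pi> v = g"
proof -
  have "g \<in> \<pi> ` carrier F"
    using assms \<pi>_surj by simp
  then obtain v where "g = \<pi> v" "v \<in> carrier F"
    by (rule imageE)
  then show ?thesis
    by (intro that[of v]) simp_all
qed

text \<open>The \<open>c\<close>-fold commutator of \<open>u\<close> with \<open>g\<close> represents an element of the \<open>c\<close>-th term of the lower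
  central series, which is trivial, so it lies in the normal closure of the relators. Its derivative
  is \<open>(1 - val g)\<^sup>c D u\<close>.\<close>

lemma (in presented_cover) relation_span_contains_nilpotent_multiple:
  assumes nil: "lower_central_series G c = {\<one>}"
    and u: "u \<in> carrier F" "val u = 1" and g: "g \<in> carrier F"
  shows "(\<lambda>i. (val g - 1) ^ c * D u i) \<in> relation_span (length rs) rs"
proof -
  let ?w = "iterated_commutator F c u g"
  have wF: "?w \<in> carrier F"
    using u g by (intro F.iterated_commutator_closed)
  have \<pi>: "group_hom F G \<pi>"
    by (intro group_hom.intro group_hom_axioms.intro group_free_group \<pi>_hom is_group)
  have closed: "\<pi> v \<in> carrier G" if "v \<in> carrier F" for v
    using group_hom.hom_closed[OF \<pi> that] .
  have "\<pi> ?w = iterated_commutator G c (\<pi> u) (\<pi> g)"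
    by (rule iterated_commutator_hom[OF \<pi> u(1) g])
  also have "\<dots> \<in> lower_central_series G c"
    by (intro iterated_commutator_in_lower_central_series closed u(1) g)
  finally have "\<pi> ?w = \<one>"
    using nil by simp
  then have "?w \<in> normal_closure F (set rs)"
    by (rule \<pi>_kernel[OF wF])
  moreover have "val r = 1" if "r \<in> set rs" for r
    using that relators_in_free_group val_eq[of r] by (auto simp: \<pi>_relator \<theta>_one monomial_0)
  ultimately have "D ?w \<in> relation_span (length rs) rs"
    using relators_in_free_group by (intro D_normal_closure)
  then have "(\<lambda>i. (-1) ^ c * D ?w i) \<in> relation_span (length rs) rs"
    by (rule relation_span_scale)
  moreover have "(-1) ^ c * D ?w i = (val g - 1) ^ c * D u i" for i
  proof -
    have "(-1) ^ c * D ?w i = ((-1) * (1 - val g)) ^ c * D u i"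
      unfolding D_iterated_commutator(1)[OF u(1) g u(2)] power_mult_distrib by (simp add: mult.assoc)
    then show ?thesis
      by simp
  qed
  ultimately show ?thesis
    by simp
qed

text \<open>This is where the presentation has to be balanced: the matrix with columns \<open>D r\<^sub>j\<close> is square.
  The image of \<open>\<theta>\<close> being nontrivial, some entry \<open>b p = x\<^sub>p - 1\<close> of the boundary map is nonzero.\<close>

lemma (in presented_cover) fox_in_relation_span:
  assumes nil: "lower_central_series G c = {\<one>}" and balanced: "length rs = n"
    and a: "a > 0"
    and E: "\<And>t. t \<in> {(int a, 0, 0), (0, int a, 0), (0, 0, int a)} \<Longrightarrow> \<exists>g\<in>carrier G. \<theta> g = t"
    and w: "w \<in> carrier F" "val w = 1"
  shows "D w \<in> relation_span (length rs) rs"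
proof -
  have multiple: "\<exists>l. \<forall>i<n. (\<Sum>j<n. D (rs ! j) i * l j) = (monomial t - 1) ^ c * D u i"
    if t: "t \<in> {(int a, 0, 0), (0, int a, 0), (0, 0, int a)}" and u: "u \<in> carrier F" "val u = 1" for t u
  proof -
    obtain g where g: "g \<in> carrier G" "\<theta> g = t"
      using E[OF t] by blast
    obtain v where v: "v \<in> carrier F" "\<pi> v = g"
      using obtain_word[OF g(1)] .
    then have "val v = monomial t"
      using g by (simp add: val_eq)
    with relation_span_contains_nilpotent_multiple[OF nil u v(1)]
    have "(\<lambda>i. (monomial t - 1) ^ c * D u i) \<in> relation_span n rs"
      by (simp add: balanced)
    then obtain l where "\<forall>i\<in>{..<n}. (monomial t - 1) ^ c * D u i = (\<Sum>j<n. D (rs ! j) i * l j)"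
      unfolding relation_span_def by (elim CollectE exE)
    then show ?thesis
      by (intro exI[of _ l]) simp
  qed
  define b where "b i = \<xi> (i, True) - 1" for i
  have "\<exists>p<n. b p \<noteq> 0"
  proof (rule ccontr)
    assume "\<not> (\<exists>p<n. b p \<noteq> 0)"
    then have "\<xi> (i, True) = 1" if "i < n" for i
      using that by (simp add: b_def)
    moreover have "\<xi> (i, False) = 1" if "i < n" for i
      using \<xi>_inverse[of "(i, True)"] calculation[OF that] by (simp add: inv_letter_def)
    ultimately have \<xi>1: "\<xi> p = 1" if "fst p < n" for p
      using that by (cases p; cases "snd p") auto
    obtain g where g: "g \<in> carrier G" "\<theta> g = (int a, 0, 0)"
      using E by blast
    obtain v where v: "v \<in> carrier F" "\<pi> v = g"
      using obtain_word[OF g(1)] .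
    have "val v = 1"
      using v(1)
    proof (induction v rule: free_group_word_induct)
      case (Cons p w)
      then show ?case
        using \<xi>1[of p] by (simp add: val_mult)
    qed simp
    then have "monomial (int a, 0, 0) = monomial 0"
      using v g val_eq[of v] by (simp add: monomial_0)
    then show False
      using a by (simp add: inj_monomial zero_prod_def)
  qed
  then obtain p where p: "p < n" "b p \<noteq> 0"
    by blast
  have "\<exists>l. \<forall>i<n. (\<Sum>j<n. D (rs ! j) i * l j) = D w i"
  proof (rule laurent3_image_of_square_matrix_saturated[where a = a and k = c and p = p and b = b])
    show "a > 0" "p < n" "b p \<noteq> 0"
      by (fact a p)+
    show "\<exists>l. \<forall>i<n. (\<Sum>j<n. D (rs ! j) i * l j) =
        e * (if i = q then b p else if i = p then - b q else 0)"
      if q: "q < n" "q \<noteq> p" and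
        e: "e \<in> (\<lambda>t. (monomial t - 1) ^ c) ` {(int a, 0, 0), (0, int a, 0), (0, 0, int a)}" for q e
    proof -
      let ?x = "[(p, True)]" and ?y = "[(q, True)]"
      let ?u = "?x \<otimes>\<^bsub>F\<^esub> ?y \<otimes>\<^bsub>F\<^esub> inv\<^bsub>F\<^esub> ?x \<otimes>\<^bsub>F\<^esub> inv\<^bsub>F\<^esub> ?y"
      have xy: "?x \<in> carrier F" "?y \<in> carrier F"
        using p q by (simp_all add: singleton_in_free_group)
      then have u: "?u \<in> carrier F" "val ?u = 1"
        by (simp, intro val_commutator)
      have D: "D ?u i = (if i = q then b p else if i = p then - b q else 0)" for i
        unfolding D_commutator[OF xy] using q(2) by (auto simp: b_def)
      from e obtain t where t: "t \<in> {(int a, 0, 0), (0, int a, 0), (0, 0, int a)}"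
        and e: "e = (monomial t - 1) ^ c"
        by (rule imageE) (rule that)
      show ?thesis
        unfolding e using multiple[OF t u] by (simp only: D)
    qed
    show "\<exists>l. \<forall>i<n. (\<Sum>j<n. D (rs ! j) i * l j) = e * D w i"
      if "e \<in> (\<lambda>t. (monomial t - 1) ^ c) ` {(int a, 0, 0), (0, int a, 0), (0, 0, int a)}" for e
      using that multiple[OF _ w] by auto
  qed
  then obtain l where "\<forall>i<n. (\<Sum>j<n. D (rs ! j) i * l j) = D w i" ..
  then have "\<forall>i\<in>{..<n}. D w i = (\<Sum>j<length rs. D (rs ! j) i * l j)"
    by (simp add: balanced)
  then show ?thesis
    unfolding relation_span_def by (intro CollectI exI[of _ l])
qed

text \<open>Given \<open>k\<close> in \<open>K\<close>, the argument is applied to a word for the conjugate of \<open>k\<close> by \<open>sec 0\<close>, whose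
  lift at \<open>0\<close> is \<open>k\<close> itself.\<close>

lemma (in presented_cover) kernel_perfect:
  assumes "lower_central_series G c = {\<one>}" "length rs = n" "a > 0"
    and "\<And>t. t \<in> {(int a, 0, 0), (0, int a, 0), (0, 0, int a)} \<Longrightarrow> \<exists>g\<in>carrier G. \<theta> g = t"
  shows "K \<subseteq> derived GK K"
proof
  fix k assume k: "k \<in> K"
  let ?s = "sec 0" and ?k = "inv (sec 0) \<otimes> k \<otimes> sec 0"
  have kG: "k \<in> carrier G" "\<theta> k = 0"
    using k by (auto simp: K_def)
  have kK: "?k \<in> K"
    using kG by (simp add: K_def \<theta>_mult \<theta>_inv sec)
  then have "?k \<in> carrier G"
    by (simp add: K_def)
  then obtain w where w: "w \<in> carrier F" "\<pi> w = ?k"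
    by (rule obtain_word)
  have "val w = 1"
    using w kK by (simp add: val_eq K_def monomial_0)
  then have "D w \<in> relation_span (length rs) rs"
    by (intro fox_in_relation_span[OF assms(1-3) _ w(1)] assms(4))
  then have "lift 0 ?k \<in> derived GK K"
    using relation_span_imp_derived[OF w(1)] w kK by simp
  moreover have "lift 0 ?k = k"
  proof -
    have "\<theta> ?k = 0"
      using kK by (simp add: K_def)
    then have "lift 0 ?k = (?s \<otimes> inv ?s) \<otimes> (k \<otimes> (?s \<otimes> inv ?s))"
      using kG sec(1)[of 0] by (simp add: lift_def m_assoc del: r_inv Units_r_inv)
    then show ?thesis
      using kG sec(1)[of 0] by simp
  qed
  ultimately show "k \<in> derived GK K"
    by simp
qed

text \<open>By induction, a subgroup \<open>H = [H, H]\<close> lies in every term of the lower central series.\<close>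

lemma (in group) perfect_subgroup_of_nilpotent_trivial:
  assumes nil: "lower_central_series G c = {\<one>}" and H: "subgroup H G"
    and perfect: "H \<subseteq> derived (G\<lparr>carrier := H\<rparr>) H"
  shows "H = {\<one>}"
proof -
  have "H \<subseteq> lower_central_series G k" for k
  proof (induction k)
    case 0
    show ?case
      using subgroup.subset[OF H] by simp
  next
    case (Suc k)
    have "H \<subseteq> derived G H"
      using perfect derived_consistent[OF order_refl H] by simp
    also have "\<dots> \<subseteq> commutator_subgroup G (lower_central_series G k) (carrier G)"
      unfolding derived_def commutator_subgroup_def
      using Suc.IH subgroup.subset[OF H] by (intro mono_generate) blast
    finally show ?case
      by simp
  qed
  from this[of c] show ?thesis
    using nil subgroup.one_closed[OF H] by auto
qed

lemma (in presented_cover) kernel_trivial: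
  assumes "lower_central_series G c = {\<one>}" "length rs = n" "a > 0"
    and "\<And>t. t \<in> {(int a, 0, 0), (0, int a, 0), (0, 0, int a)} \<Longrightarrow> \<exists>g\<in>carrier G. \<theta> g = t"
  shows "K = {\<one>}"
  by (intro perfect_subgroup_of_nilpotent_trivial[OF assms(1) subgroup_K] kernel_perfect[OF assms(1-3)] assms(4))


section \<open>Subgroups of finite index in the free abelian group of rank three\<close>

text \<open>The image of \<open>f\<close> is generated by its least positive element \<open>d\<close>, and a preimage \<open>t\<close> of \<open>d\<close> splits
  off an infinite cyclic factor.\<close>

lemma (in comm_group) split_off_integers:
  assumes f: "f \<in> hom G integer_group" and nz: "\<exists>g\<in>carrier G. f g \<noteq> 0"
  shows "G \<cong> integer_group \<times>\<times> G\<lparr>carrier := kernel G integer_group f\<rparr>"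
proof -
  interpret f: group_hom G integer_group f
    by (intro group_hom.intro group_hom_axioms.intro is_group group_integer_group f)
  have f_mult: "f (x \<otimes> y) = f x + f y" if "x \<in> carrier G" "y \<in> carrier G" for x y
    using f.hom_mult[OF that] by (simp add: integer_group_def)
  have f_inv: "f (inv x) = - f x" if "x \<in> carrier G" for x
    using f.hom_inv[OF that] by simp
  have f_one: "f \<one> = 0"
    using f.hom_one by simp
  have f_pow: "f (x [^] k) = k * f x" if "x \<in> carrier G" for x and k :: int
    using f.hom_int_pow[OF that, of k] by (simp add: mult.commute)
  define P where "P d \<longleftrightarrow> d > 0 \<and> (\<exists>g\<in>carrier G. f g = int d)" for d :: nat
  obtain g0 where g0: "g0 \<in> carrier G" "f g0 \<noteq> 0"
    using nz by blast
  have "P (nat \<bar>f g0\<bar>)"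
  proof (cases "f g0 > 0")
    case False
    then show ?thesis
      using g0 by (auto simp: P_def f_inv intro!: bexI[of _ "inv g0"])
  qed (use g0 in \<open>auto simp: P_def\<close>)
  then have P: "P (LEAST d. P d)"
    by (rule LeastI)
  define d where "d = (LEAST d. P d)"
  from P have "P d"
    by (simp only: d_def)
  then obtain t where d: "d > 0" and t: "t \<in> carrier G" "f t = int d"
    unfolding P_def by blast
  have dvd: "int d dvd f x" if x: "x \<in> carrier G" for x
  proof (rule ccontr)
    assume "\<not> int d dvd f x"
    then have pos: "f x mod int d > 0"
      using d by (metis mod_0_imp_dvd of_nat_0_less_iff order_le_less pos_mod_sign)
    let ?y = "x \<otimes> inv (t [^] (f x div int d))"
    have "f ?y = f x mod int d"
      using x t by (simp add: f_mult f_inv f_pow minus_div_mult_eq_mod[symmetric])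
    then have "P (nat (f x mod int d))"
      using pos x t by (auto simp: P_def intro!: bexI[of _ ?y])
    then have "d \<le> nat (f x mod int d)"
      unfolding d_def by (rule Least_le)
    moreover have "f x mod int d < int d"
      using d by simp
    ultimately show False
      using pos by linarith
  qed
  let ?N = "kernel G integer_group f"
  define \<phi> where "\<phi> x = (f x div int d, x \<otimes> inv (t [^] (f x div int d)))" for x
  have closed: "x \<otimes> inv (t [^] (f x div int d)) \<in> ?N" if "x \<in> carrier G" for x
    using that t dvd[OF that] by (simp add: kernel_def f_mult f_inv f_pow)
  have "\<phi> \<in> iso G (integer_group \<times>\<times> G\<lparr>carrier := ?N\<rparr>)"
  proof (rule isoI)
    show "\<phi> \<in> hom G (integer_group \<times>\<times> G\<lparr>carrier := ?N\<rparr>)"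
    proof (rule homI)
      fix x y assume xy: "x \<in> carrier G" "y \<in> carrier G"
      have "f (x \<otimes> y) div int d = f x div int d + f y div int d"
        using xy dvd by (simp add: f_mult)
      then show "\<phi> (x \<otimes> y) = \<phi> x \<otimes>\<^bsub>integer_group \<times>\<times> G\<lparr>carrier := ?N\<rparr>\<^esub> \<phi> y"
        using xy t by (simp add: \<phi>_def int_pow_mult inv_mult m_ac)
    qed (use closed in \<open>simp add: \<phi>_def\<close>)
    show "bij_betw \<phi> (carrier G) (carrier (integer_group \<times>\<times> G\<lparr>carrier := ?N\<rparr>))"
    proof (rule bij_betw_byWitness[where f' = "\<lambda>(k, x). x \<otimes> t [^] k"])
      show "\<forall>x\<in>carrier G. (case \<phi> x of (k, x) \<Rightarrow> x \<otimes> t [^] k) = x"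
        using t by (simp add: \<phi>_def m_assoc)
      show "\<forall>z\<in>carrier (integer_group \<times>\<times> G\<lparr>carrier := ?N\<rparr>). \<phi> (case z of (k, x) \<Rightarrow> x \<otimes> t [^] k) = z"
        using t d by (auto simp: \<phi>_def kernel_def f_mult f_pow m_assoc)
      show "\<phi> ` carrier G \<subseteq> carrier (integer_group \<times>\<times> G\<lparr>carrier := ?N\<rparr>)"
        using closed by (auto simp: \<phi>_def)
      show "(\<lambda>(k, x). x \<otimes> t [^] k) ` carrier (integer_group \<times>\<times> G\<lparr>carrier := ?N\<rparr>) \<subseteq> carrier G"
        using t by (auto simp: kernel_def)
    qed
  qed
  then show ?thesis
    by (rule is_isoI)
qed

lemma (in comm_group) comm_group_subgroup:
  assumes "subgroup H G"
  shows "comm_group (G\<lparr>carrier := H\<rparr>)"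
proof (rule group.group_comm_groupI)
  show "group (G\<lparr>carrier := H\<rparr>)"
    using assms is_group by (rule subgroup.subgroup_is_group)
qed (use subgroup.mem_carrier[OF assms] in \<open>simp add: m_comm\<close>)

lemma DirProd_trivial_is_iso:
  assumes "group G" "carrier H = {\<one>\<^bsub>H\<^esub>}" "group H"
  shows "G \<times>\<times> H \<cong> G"
proof -
  interpret H: group H by fact
  have "fst \<in> iso (G \<times>\<times> H) G"
    using assms(2) by (auto simp: iso_def hom_def bij_betw_def inj_on_def image_iff)
  then show ?thesis
    by (rule is_isoI)
qed

text \<open>The three coordinates of \<open>\<theta>\<close> are used one after the other, each restricted to the common
  kernel of the previous ones, where it is still nonzero. After three steps nothing is left.\<close>

lemma (in group) iso_integers_cubed:
  fixes \<theta> :: "'a \<Rightarrow> int \<times> int \<times> int"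
  assumes mult: "\<And>g h. g \<in> carrier G \<Longrightarrow> h \<in> carrier G \<Longrightarrow> \<theta> (g \<otimes> h) = \<theta> g + \<theta> h"
    and inj: "\<And>g. g \<in> carrier G \<Longrightarrow> \<theta> g = 0 \<Longrightarrow> g = \<one>"
    and a: "a > 0"
    and E: "\<And>t. t \<in> {(int a, 0, 0), (0, int a, 0), (0, 0, int a)} \<Longrightarrow> \<exists>g\<in>carrier G. \<theta> g = t"
  shows "G \<cong> integer_group \<times>\<times> integer_group \<times>\<times> integer_group"
proof -
  have one: "\<theta> \<one> = 0"
    using mult[of \<one> \<one>] by simp
  have inv: "\<theta> (inv g) = - \<theta> g" if "g \<in> carrier G" for g
    using mult[of "inv g" g] that by (simp add: one eq_neg_iff_add_eq_0)
  have comm: "g \<otimes> h = h \<otimes> g" if "g \<in> carrier G" "h \<in> carrier G" for g h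
  proof -
    have "g \<otimes> h \<otimes> inv (h \<otimes> g) = \<one>"
      using that by (intro inj) (simp_all add: mult inv)
    then show ?thesis
      using that by (metis inv_closed inv_equality inv_inv m_closed)
  qed
  interpret comm_group G
    by (rule group_comm_groupI) (rule comm)
  define f1 where "f1 g = fst (\<theta> g)" for g
  define f2 where "f2 g = fst (snd (\<theta> g))" for g
  define f3 where "f3 g = snd (snd (\<theta> g))" for g
  let ?N1 = "kernel G integer_group f1"
  let ?G1 = "G\<lparr>carrier := ?N1\<rparr>"
  let ?N2 = "kernel ?G1 integer_group f2"
  let ?G2 = "?G1\<lparr>carrier := ?N2\<rparr>"
  let ?N3 = "kernel ?G2 integer_group f3"
  let ?G3 = "?G2\<lparr>carrier := ?N3\<rparr>"
  have hom1: "f1 \<in> hom G integer_group"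
    by (auto simp: hom_def f1_def mult)
  have hom2: "f2 \<in> hom ?G1 integer_group"
    by (auto simp: hom_def f2_def mult kernel_def)
  have hom3: "f3 \<in> hom ?G2 integer_group"
    by (auto simp: hom_def f3_def mult kernel_def)
  have sub1: "subgroup ?N1 G"
    by (intro group_hom.subgroup_kernel group_hom.intro group_hom_axioms.intro hom1 is_group) simp
  interpret G1: comm_group ?G1
    by (rule comm_group_subgroup[OF sub1])
  have sub2: "subgroup ?N2 ?G1"
    by (intro group_hom.subgroup_kernel group_hom.intro group_hom_axioms.intro hom2 G1.is_group) simp
  interpret G2: comm_group ?G2
    by (rule G1.comm_group_subgroup[OF sub2])
  have sub3: "subgroup ?N3 ?G2"
    by (intro group_hom.subgroup_kernel group_hom.intro group_hom_axioms.intro hom3 G2.is_group) simp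
  interpret G3: comm_group ?G3
    by (rule G2.comm_group_subgroup[OF sub3])
  obtain g1 g2 g3 where g: "g1 \<in> carrier G" "\<theta> g1 = (int a, 0, 0)" "g2 \<in> carrier G" "\<theta> g2 = (0, int a, 0)"
      "g3 \<in> carrier G" "\<theta> g3 = (0, 0, int a)"
    using E[of "(int a, 0, 0)"] E[of "(0, int a, 0)"] E[of "(0, 0, int a)"] by auto
  have iso1: "G \<cong> integer_group \<times>\<times> ?G1"
    using g a by (intro split_off_integers hom1 bexI[of _ g1]) (auto simp: f1_def)
  have iso2: "?G1 \<cong> integer_group \<times>\<times> ?G2"
    using g a by (intro G1.split_off_integers hom2 bexI[of _ g2]) (auto simp: f1_def f2_def kernel_def)
  have iso3: "?G2 \<cong> integer_group \<times>\<times> ?G3"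
    using g a by (intro G2.split_off_integers hom3 bexI[of _ g3]) (auto simp: f1_def f2_def f3_def kernel_def)
  have "\<theta> g = 0" if "g \<in> ?N3" for g
    using that by (cases "\<theta> g") (simp add: kernel_def f1_def f2_def f3_def zero_prod_def)
  moreover have "?N3 \<subseteq> carrier G"
    by (auto simp: kernel_def)
  ultimately have "?N3 \<subseteq> {\<one>}"
    using inj by blast
  then have "carrier ?G3 = {\<one>\<^bsub>?G3\<^esub>}"
    using G3.one_closed by auto
  then have "integer_group \<times>\<times> ?G3 \<cong> integer_group"
    by (rule DirProd_trivial_is_iso[OF group_integer_group _ G3.is_group])
  then have "?G2 \<cong> integer_group"
    by (rule iso_trans[OF iso3])
  then have "?G1 \<cong> integer_group \<times>\<times> integer_group"
    using iso_trans[OF iso2 group.DirProd_iso_trans[OF group_integer_group iso_refl]] by blast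
  then show ?thesis
    using iso_trans[OF iso1 group.DirProd_iso_trans[OF group_integer_group iso_refl]] by blast
qed


section \<open>Quotient maps of presentations\<close>

lemma presentation_homomorphism:
  fixes G :: "('a, 'b) monoid_scheme"
  assumes G: "group G" and R: "R \<subseteq> carrier (free_group X)" and iso: "G \<cong> presented_group X R"
  obtains \<pi> where "\<pi> \<in> hom (free_group X) G" "\<pi> ` carrier (free_group X) = carrier G"
    "\<And>r. r \<in> R \<Longrightarrow> \<pi> r = \<one>\<^bsub>G\<^esub>"
    "\<And>w. w \<in> carrier (free_group X) \<Longrightarrow> \<pi> w = \<one>\<^bsub>G\<^esub> \<Longrightarrow> w \<in> normal_closure (free_group X) R"
proof -
  let ?F = "free_group X" and ?N = "normal_closure (free_group X) R"
  let ?P = "presented_group X R"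
  interpret G: group G by fact
  interpret F: group ?F by (rule group_free_group)
  interpret N: normal ?N ?F by (rule normal_normal_closure[OF F.is_group R])
  have P: "?P = ?F Mod ?N"
    by (simp add: presented_group_def)
  interpret P: group ?P
    unfolding P by (rule N.factorgroup_is_group)
  obtain h where "h \<in> iso G ?P"
    using iso by (auto simp: is_iso_def)
  then have "inv_into (carrier G) h \<in> iso ?P G"
    by (rule G.iso_set_sym)
  then obtain k where k: "k \<in> hom ?P G" "bij_betw k (carrier ?P) (carrier G)"
    by (auto simp: iso_def)
  interpret k: group_hom ?P G k
    by (intro group_hom.intro group_hom_axioms.intro k(1) P.is_group G)
  have quot: "(\<lambda>w. ?N #>\<^bsub>?F\<^esub> w) \<in> hom ?F ?P"
    unfolding P by (rule N.r_coset_hom_Mod)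
  have carrier_P: "carrier ?P = (\<lambda>w. ?N #>\<^bsub>?F\<^esub> w) ` carrier ?F"
    by (auto simp: P FactGroup_def RCOSETS_def)
  have one_P: "\<one>\<^bsub>?P\<^esub> = ?N"
    by (simp add: P FactGroup_def)
  define \<pi> where "\<pi> w = k (?N #>\<^bsub>?F\<^esub> w)" for w
  show ?thesis
  proof (rule that[of \<pi>])
    show "\<pi> \<in> hom ?F G"
      using hom_compose[OF quot k(1)] by (simp add: \<pi>_def[abs_def] comp_def)
    show "\<pi> ` carrier ?F = carrier G"
      using k(2) by (simp add: bij_betw_def carrier_P \<pi>_def[abs_def] image_image)
    show "\<pi> r = \<one>\<^bsub>G\<^esub>" if "r \<in> R" for r
    proof -
      have "r \<in> ?N"
        using that hull_subset[of R "\<lambda>N. N \<lhd> ?F"] by (auto simp: normal_closure_def)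
      then have "?N #>\<^bsub>?F\<^esub> r = ?N"
        by (rule N.rcos_const[OF F.is_group])
      then have "\<pi> r = k \<one>\<^bsub>?P\<^esub>"
        by (simp add: \<pi>_def one_P)
      then show ?thesis
        by simp
    qed
    show "w \<in> ?N" if w: "w \<in> carrier ?F" "\<pi> w = \<one>\<^bsub>G\<^esub>" for w
    proof -
      have "k (?N #>\<^bsub>?F\<^esub> w) = k \<one>\<^bsub>?P\<^esub>"
        using w by (simp add: \<pi>_def)
      moreover have "?N #>\<^bsub>?F\<^esub> w \<in> carrier ?P"
        unfolding carrier_P using w(1) by (rule imageI)
      ultimately have "?N #>\<^bsub>?F\<^esub> w = \<one>\<^bsub>?P\<^esub>"
        using k(2) inj_onD[of k "carrier ?P"] by (simp add: bij_betw_def)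
      then have "?N #>\<^bsub>?F\<^esub> w = ?N"
        by (simp add: one_P)
      then show ?thesis
        using w(1) F.coset_join1 N.subset N.subgroup_axioms by blast
    qed
  qed
qed


section \<open>First rational homology\<close>

lemma (in vectorspace) basis_coordinates:
  assumes fin: "finite \<beta>" and basis: "basis \<beta>"
  shows "\<exists>co. (\<forall>v\<in>carrier V. \<forall>w\<in>carrier V. \<forall>b\<in>\<beta>. co (v \<oplus>\<^bsub>V\<^esub> w) b = co v b \<oplus>\<^bsub>K\<^esub> co w b) \<and>
    (\<forall>b\<in>\<beta>. \<forall>c\<in>\<beta>. co b c = (if c = b then \<one>\<^bsub>K\<^esub> else \<zero>\<^bsub>K\<^esub>))"
proof -
  have \<beta>: "\<beta> \<subseteq> carrier V"
    using basis by (simp add: basis_def)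
  have ex1: "\<exists>!a. a \<in> \<beta> \<rightarrow>\<^sub>E carrier K \<and> lincomb a \<beta> = v" if "v \<in> carrier V" for v
    using basis_criterion[OF fin \<beta>] basis that by blast
  define co where "co v = (THE a. a \<in> \<beta> \<rightarrow>\<^sub>E carrier K \<and> lincomb a \<beta> = v)" for v
  have co: "co v \<in> \<beta> \<rightarrow>\<^sub>E carrier K" "lincomb (co v) \<beta> = v" if "v \<in> carrier V" for v
    using theI'[OF ex1[OF that]] by (simp_all add: co_def)
  have unique: "co v b = a b"
    if v: "v \<in> carrier V" and a: "a \<in> \<beta> \<rightarrow> carrier K" "lincomb a \<beta> = v" and b: "b \<in> \<beta>" for v a b
  proof -
    have "restrict a \<beta> \<in> \<beta> \<rightarrow>\<^sub>E carrier K"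
      using a by auto
    moreover have "lincomb (restrict a \<beta>) \<beta> = v"
      unfolding a(2)[symmetric] using a(1) \<beta> by (intro lincomb_cong) auto
    ultimately have "co v = restrict a \<beta>"
      unfolding co_def by (intro the1_equality[OF ex1[OF v]] conjI)
    then show ?thesis
      using b by simp
  qed
  show ?thesis
  proof (intro exI[of _ co] conjI ballI)
    show "co (v \<oplus>\<^bsub>V\<^esub> w) b = co v b \<oplus>\<^bsub>K\<^esub> co w b"
      if vw: "v \<in> carrier V" "w \<in> carrier V" and b: "b \<in> \<beta>" for v w b
    proof (rule unique[OF _ _ _ b])
      have *: "co v \<in> \<beta> \<rightarrow> carrier K" "co w \<in> \<beta> \<rightarrow> carrier K"
        using co(1)[OF vw(1)] co(1)[OF vw(2)] by auto
      show "v \<oplus>\<^bsub>V\<^esub> w \<in> carrier V"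
        using vw by simp
      show "(\<lambda>b. co v b \<oplus>\<^bsub>K\<^esub> co w b) \<in> \<beta> \<rightarrow> carrier K"
        using * by (auto simp: Pi_iff)
      show "lincomb (\<lambda>b. co v b \<oplus>\<^bsub>K\<^esub> co w b) \<beta> = v \<oplus>\<^bsub>V\<^esub> w"
        using lincomb_sum[OF fin \<beta> *] co(2) vw by simp
    qed
    show "co b c = (if c = b then \<one>\<^bsub>K\<^esub> else \<zero>\<^bsub>K\<^esub>)" if b: "b \<in> \<beta>" and c: "c \<in> \<beta>" for b c
    proof (rule unique[OF _ _ _ c])
      let ?e = "\<lambda>c. if c = b then \<one>\<^bsub>K\<^esub> else \<zero>\<^bsub>K\<^esub>"
      show bV: "b \<in> carrier V"
        using b \<beta> by blast
      show e: "?e \<in> \<beta> \<rightarrow> carrier K"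
        by auto
      have "lincomb ?e \<beta> = ?e b \<odot>\<^bsub>V\<^esub> b \<oplus>\<^bsub>V\<^esub> lincomb ?e (\<beta> - {b})"
        by (rule lincomb_del2[OF fin \<beta> e b])
      also have "lincomb ?e (\<beta> - {b}) = \<zero>\<^bsub>V\<^esub>"
        unfolding lincomb_def using \<beta> by (intro M.finsum_all0) auto
      finally show "lincomb ?e \<beta> = b"
        using bV by simp
    qed
  qed
qed

lemma rats_common_denominator:
  assumes "finite (Q :: rat set)"
  shows "\<exists>d>0. \<forall>q\<in>Q. of_nat d * q \<in> \<int>"
  using assms
proof (induction Q)
  case empty
  show ?case
    by (intro exI[of _ 1]) simp
next
  case (insert q Q)
  then obtain d where d: "d > 0" "\<forall>q\<in>Q. of_nat d * q \<in> \<int>"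
    by blast
  obtain a b where ab: "q = of_int a / of_int b" "b > 0"
    by (metis quotient_of_denom_pos quotient_of_div prod.collapse)
  then have q: "of_nat (nat b) * q = of_int a"
    by (simp add: of_nat_nat)
  have "of_nat (d * nat b) * q = of_nat d * of_int a"
    unfolding of_nat_mult mult.assoc q ..
  then have "of_nat (d * nat b) * q \<in> \<int>"
    by (simp only: Ints_mult Ints_of_nat Ints_of_int)
  moreover have "of_nat (d * nat b) * r \<in> \<int>" if "r \<in> Q" for r
  proof -
    have "of_nat (d * nat b) * r = of_nat (nat b) * (of_nat d * r)"
      by simp
    moreover have "of_nat (nat b) * (of_nat d * r) \<in> \<int>"
      by (rule Ints_mult[OF Ints_of_nat bspec[OF d(2) that]])
    ultimately show ?thesis
      by (simp only:)
  qed
  moreover have "d * nat b > 0"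
    using d ab by simp
  ultimately show ?case
    by (intro exI[of _ "d * nat b"]) auto
qed

locale bar_degree_one = group G for G (structure)
begin

definition "H = rat_homology G 1"

definition "C = bar_chains G 1"

sublocale H: vectorspace class_ring H
  unfolding H_def by (rule vectorspace_rat_homology) (rule is_monoid)

definition "B = bar_boundaries G 1"

definition quot :: "('a list \<Rightarrow>\<^sub>0 rat) \<Rightarrow> ('a list \<Rightarrow>\<^sub>0 rat) set" where
  "quot c = (\<lambda>b. b + c) ` B"

lemma keys_C: "c \<in> carrier C \<Longrightarrow> gs \<in> Poly_Mapping.keys c \<Longrightarrow> \<exists>g\<in>carrier G. gs = [g]"
  by (fastforce simp: C_def bar_chains_def length_Suc_conv)

lemma cycles: "bar_cycles G 1 = carrier C"
proof -
  have "bar_boundary G c = 0" if c: "c \<in> carrier C" for c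
  proof -
    have "bar_boundary G (Poly_Mapping.single gs q) = 0" if gs: "gs \<in> Poly_Mapping.keys c" for gs q
    proof -
      obtain g where "gs = [g]"
        using keys_C[OF c gs] by blast
      then show ?thesis
        by (simp add: bar_boundary_single bar_face_def single_add[symmetric])
    qed
    then show ?thesis
      by (subst poly_mapping_eq_sum_single) (simp add: bar_boundary_sum)
  qed
  then show ?thesis
    by (auto simp: bar_cycles_def C_def)
qed

lemma B_add: "a \<in> B \<Longrightarrow> b \<in> B \<Longrightarrow> a + b \<in> B"
proof -
  interpret C: vectorspace class_ring "bar_chains G (Suc 1)"
    by (rule vectorspace_bar_chains)
  assume "a \<in> B" "b \<in> B"
  then obtain c d where c: "c \<in> carrier (bar_chains G (Suc 1))" "a = bar_boundary G c"
    and d: "d \<in> carrier (bar_chains G (Suc 1))" "b = bar_boundary G d"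
    unfolding B_def bar_boundaries_def by blast
  have "c + d \<in> carrier (bar_chains G (Suc 1))"
    using C.M.a_closed[OF c(1) d(1)] by (simp add: bar_chains_def)
  then show "a + b \<in> B"
    unfolding B_def bar_boundaries_def c(2) d(2) bar_boundary_add[symmetric] by (rule imageI)
qed

lemma B_scale: "a \<in> B \<Longrightarrow> Poly_Mapping.map ((*) q) a \<in> B"
proof -
  interpret C: vectorspace class_ring "bar_chains G (Suc 1)"
    by (rule vectorspace_bar_chains)
  assume "a \<in> B"
  then obtain c where c: "c \<in> carrier (bar_chains G (Suc 1))" "a = bar_boundary G c"
    unfolding B_def bar_boundaries_def by blast
  have "Poly_Mapping.map ((*) q) c \<in> carrier (bar_chains G (Suc 1))"
    using C.smult_closed[OF _ c(1), of q] by (simp add: bar_chains_def)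
  then show "Poly_Mapping.map ((*) q) a \<in> B"
    unfolding B_def bar_boundaries_def c(2) bar_boundary_scale[symmetric] by (rule imageI)
qed

lemma B_zero: "0 \<in> B"
  unfolding B_def bar_boundaries_def
  by (rule image_eqI[of _ _ 0]) (simp_all add: bar_chains_def)

lemma B_uminus: "a \<in> B \<Longrightarrow> - a \<in> B"
proof -
  have "Poly_Mapping.map ((*) (- 1)) a = - a"
    by (rule poly_mapping_eqI) simp
  then show "a \<in> B \<Longrightarrow> - a \<in> B"
    using B_scale[of a "- 1"] by simp
qed

lemma quot_eq: "c - d \<in> B \<Longrightarrow> quot c = quot d"
proof -
  have "quot c \<subseteq> quot d" if "c - d \<in> B" for c d
  proof
    fix x assume "x \<in> quot c"
    then obtain b where b: "b \<in> B" "x = b + c"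
      by (auto simp: quot_def)
    then have "x = (b + (c - d)) + d"
      by simp
    then show "x \<in> quot d"
      unfolding quot_def using B_add[OF b(1) that] by (rule image_eqI)
  qed
  note sub = this
  assume *: "c - d \<in> B"
  have "d - c \<in> B"
    using B_uminus[OF *] by simp
  then show "quot c = quot d"
    using sub[OF *] sub by blast
qed

lemma carrier_H: "carrier H = quot ` carrier C"
proof -
  have "B +>\<^bsub>bar_chains G 1\<lparr>carrier := carrier C\<rparr>\<^esub> x = quot x" for x
    by (auto simp: a_r_coset_def' quot_def bar_chains_def)
  then show ?thesis
    unfolding H_def rat_homology_def quotient_module_def cycles B_def[symmetric]
    by (auto simp: A_RCOSETS_def')
qed

lemma add_H: "quot c \<oplus>\<^bsub>H\<^esub> quot d = quot (c + d)"
proof -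
  have "quot c \<oplus>\<^bsub>H\<^esub> quot d = {x + y | x y. x \<in> quot c \<and> y \<in> quot d}"
    by (auto simp: H_def rat_homology_def quotient_module_def set_add_def' bar_chains_def)
  also have "\<dots> = quot (c + d)"
  proof (intro subset_antisym subsetI)
    fix z assume "z \<in> {x + y | x y. x \<in> quot c \<and> y \<in> quot d}"
    then obtain a b where ab: "a \<in> B" "b \<in> B" "z = (a + c) + (b + d)"
      by (auto simp: quot_def)
    then have "z = (a + b) + (c + d)"
      by (simp add: algebra_simps)
    then show "z \<in> quot (c + d)"
      unfolding quot_def using B_add[OF ab(1,2)] by (rule image_eqI)
  next
    fix z assume "z \<in> quot (c + d)"
    then obtain a where a: "a \<in> B" "z = a + (c + d)"
      by (auto simp: quot_def)
    have "a + c \<in> quot c" "0 + d \<in> quot d"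
      using a B_zero unfolding quot_def by blast+
    moreover have "z = (a + c) + (0 + d)"
      using a by (simp add: algebra_simps)
    ultimately show "z \<in> {x + y | x y. x \<in> quot c \<and> y \<in> quot d}"
      by blast
  qed
  finally show ?thesis .
qed

lemma smult_H: "q \<odot>\<^bsub>H\<^esub> quot c = quot (Poly_Mapping.map ((*) q) c)"
proof -
  have "q \<odot>\<^bsub>H\<^esub> quot c = (\<Union>v\<in>quot c. quot (Poly_Mapping.map ((*) q) v))"
    unfolding H_def rat_homology_def quotient_module_def B_def[symmetric]
    by (simp add: a_r_coset_def' quot_def bar_chains_def) blast
  also have "\<dots> = (\<Union>v\<in>quot c. quot (Poly_Mapping.map ((*) q) c))"
  proof (rule SUP_cong[OF refl])
    fix v assume "v \<in> quot c"
    then obtain b where b: "b \<in> B" "v = b + c"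
      by (auto simp: quot_def)
    have "Poly_Mapping.map ((*) q) v - Poly_Mapping.map ((*) q) c = Poly_Mapping.map ((*) q) b"
      by (rule poly_mapping_eqI) (simp add: b(2) lookup_minus lookup_add algebra_simps)
    then show "quot (Poly_Mapping.map ((*) q) v) = quot (Poly_Mapping.map ((*) q) c)"
      using B_scale[OF b(1)] by (intro quot_eq) simp
  qed
  also have "\<dots> = quot (Poly_Mapping.map ((*) q) c)"
    using B_zero by (auto simp: quot_def)
  finally show ?thesis .
qed

definition hcls :: "'a \<Rightarrow> ('a list \<Rightarrow>\<^sub>0 rat) set" where
  "hcls g = quot (Poly_Mapping.single [g] 1)"

lemma hcls_closed: "g \<in> carrier G \<Longrightarrow> hcls g \<in> carrier H"
  unfolding hcls_def carrier_H by (intro imageI) (simp add: C_def bar_chains_def)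

text \<open>The boundary of the \<open>2\<close>-chain \<open>[g|h]\<close> is \<open>[h] - [g h] + [g]\<close>.\<close>

lemma hcls_mult:
  assumes "g \<in> carrier G" "h \<in> carrier G"
  shows "hcls (g \<otimes> h) = hcls g \<oplus>\<^bsub>H\<^esub> hcls h"
proof -
  let ?s = "\<lambda>g. Poly_Mapping.single [g] (1::rat)"
  have faces: "bar_face G 0 [g, h] = [h]" "bar_face G (Suc 0) [g, h] = [g \<otimes> h]"
    "bar_face G (Suc (Suc 0)) [g, h] = [g]"
    by (simp_all add: bar_face_def)
  have "bar_boundary G (Poly_Mapping.single [g, h] 1) = ?s h - ?s (g \<otimes> h) + ?s g"
    by (simp add: bar_boundary_single faces single_uminus)
  moreover have "Poly_Mapping.single [g, h] (1::rat) \<in> carrier (bar_chains G (Suc 1))"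
    using assms by (simp add: bar_chains_def)
  ultimately have "?s h - ?s (g \<otimes> h) + ?s g \<in> B"
    unfolding B_def bar_boundaries_def by (metis imageI)
  then have "(?s g + ?s h) - ?s (g \<otimes> h) \<in> B"
    by (simp add: algebra_simps)
  then show ?thesis
    unfolding hcls_def add_H by (rule quot_eq[symmetric])
qed

lemma submodule_hcls_imp_carrier:
  assumes N: "submodule class_ring N H" and cls: "\<And>g. g \<in> carrier G \<Longrightarrow> hcls g \<in> N"
  shows "carrier H \<subseteq> N"
proof
  interpret N: submodule class_ring N H by fact
  fix z assume "z \<in> carrier H"
  then obtain c where c: "c \<in> carrier C" "z = quot c"
    by (auto simp: carrier_H)
  have zero: "quot 0 \<in> N"
  proof -
    have "quot 0 = 0 \<odot>\<^bsub>H\<^esub> hcls \<one>"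
      unfolding hcls_def smult_H by (intro arg_cong[where f = quot] poly_mapping_eqI) simp
    then show ?thesis
      using cls[OF one_closed] N.smult_closed[of 0 "hcls \<one>"] by simp
  qed
  have "quot (\<Sum>gs\<in>A. Poly_Mapping.single gs (Poly_Mapping.lookup c gs)) \<in> N"
    if "A \<subseteq> Poly_Mapping.keys c" for A
    using finite_subset[OF that finite_keys] that
  proof (induction A)
    case (insert gs A)
    then obtain g where g: "gs = [g]" "g \<in> carrier G"
      using keys_C[OF c(1), of gs] by blast
    have "quot (Poly_Mapping.single gs (Poly_Mapping.lookup c gs)) =
        Poly_Mapping.lookup c gs \<odot>\<^bsub>H\<^esub> hcls g"
      unfolding hcls_def smult_H g(1)
      by (intro arg_cong[where f = quot] poly_mapping_eqI) (simp add: lookup_single when_def)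
    then have "quot (Poly_Mapping.single gs (Poly_Mapping.lookup c gs)) \<in> N"
      using N.smult_closed[OF _ cls[OF g(2)]] by simp
    then show ?case
      using insert N.m_closed by (simp add: add_H[symmetric])
  qed (simp add: zero)
  from this[of "Poly_Mapping.keys c"] show "z \<in> N"
    using c(2) poly_mapping_eq_sum_single[of c] by simp
qed

end

lemma (in bar_degree_one) gen_set_generators:
  assumes \<pi>: "\<pi> \<in> hom (free_group X) G" and surj: "\<pi> ` carrier (free_group X) = carrier G"
  shows "H.gen_set ((\<lambda>i. hcls (\<pi> [(i, True)])) ` X)"
proof -
  interpret \<pi>: group_hom "free_group X" G \<pi>
    by (intro group_hom.intro group_hom_axioms.intro group_free_group \<pi> is_group)
  let ?T = "(\<lambda>i. hcls (\<pi> [(i, True)])) ` X"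
  have letter: "\<pi> [p] \<in> carrier G" if "fst p \<in> X" for p
    using that by (simp add: singleton_in_free_group)
  have T: "?T \<subseteq> carrier H"
    using letter by (auto intro!: hcls_closed)
  have sub: "submodule class_ring (H.span ?T) H"
    by (rule H.span_is_submodule[OF T])
  interpret N: submodule class_ring "H.span ?T" H
    by (rule sub)
  have one: "hcls \<one> = \<zero>\<^bsub>H\<^esub>"
  proof -
    have "hcls \<one> \<oplus>\<^bsub>H\<^esub> hcls \<one> = hcls \<one>"
      using hcls_mult[of \<one> \<one>] by simp
    then show ?thesis
      using hcls_closed[OF one_closed] by (metis H.M.add.l_cancel_one)
  qed
  have inv: "hcls (inv g) \<in> H.span ?T" if "g \<in> carrier G" "hcls g \<in> H.span ?T" for g
  proof -
    have "hcls (inv g) \<oplus>\<^bsub>H\<^esub> hcls g = \<zero>\<^bsub>H\<^esub>"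
      using hcls_mult[of "inv g" g] that by (simp add: one)
    then have "hcls (inv g) = \<ominus>\<^bsub>H\<^esub> hcls g"
      using that hcls_closed by (metis H.M.minus_equality inv_closed)
    also have "\<dots> = (\<ominus>\<^bsub>class_ring\<^esub> \<one>\<^bsub>class_ring\<^esub>) \<odot>\<^bsub>H\<^esub> hcls g"
      using hcls_closed[OF that(1)] by (rule H.smult_minus_1[symmetric])
    also have "\<dots> \<in> H.span ?T"
      using that by (intro N.smult_closed) auto
    finally show ?thesis .
  qed
  have gen: "hcls (\<pi> [(i, True)]) \<in> H.span ?T" if "i \<in> X" for i
    using that H.in_own_span[OF T] by blast
  have word: "hcls (\<pi> w) \<in> H.span ?T" if "w \<in> carrier (free_group X)" for w
    using that
  proof (induction w rule: free_group_word_induct)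
    case Nil
    have "\<pi> [] = \<one>"
      using \<pi>.hom_one by (simp add: free_group_def)
    then show ?case
      using N.zero_closed by (simp add: one)
  next
    case (Cons p w)
    have "hcls (\<pi> [p]) \<in> H.span ?T"
    proof (cases "snd p")
      case True
      then have "p = (fst p, True)"
        by (simp add: prod_eq_iff)
      then show ?thesis
        using gen[OF Cons(1)] by simp
    next
      case False
      then have p: "inv_letter p = (fst p, True)"
        by (simp add: inv_letter_def)
      have "[p] \<otimes>\<^bsub>free_group X\<^esub> [(fst p, True)] = []"
        by (simp add: free_group_def p)
      then have "\<pi> [p] \<otimes> \<pi> [(fst p, True)] = \<pi> []"
        using \<pi>.hom_mult[of "[p]" "[(fst p, True)]"] Cons(1) by (simp add: singleton_in_free_group)
      also have "\<pi> [] = \<one>"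
        using \<pi>.hom_one by (simp add: free_group_def)
      finally have "inv (\<pi> [(fst p, True)]) = \<pi> [p]"
        using letter Cons(1) by (intro inv_equality) auto
      then show ?thesis
        using inv[OF letter gen[OF Cons(1)]] Cons(1) by simp
    qed
    then show ?case
      using Cons letter[OF Cons(1)] N.m_closed by (simp add: singleton_in_free_group hcls_mult)
  qed
  have "carrier H \<subseteq> H.span ?T"
  proof (rule submodule_hcls_imp_carrier[OF sub])
    fix g assume "g \<in> carrier G"
    then have "g \<in> \<pi> ` carrier (free_group X)"
      by (simp add: surj)
    then show "hcls g \<in> H.span ?T"
      using word by auto
  qed
  then show ?thesis
    using N.subset by blast
qed

text \<open>The classes of the generators span \<open>H\<^sub>1(G; \<rat>)\<close>, so three of them form a basis. The
  coordinates with respect to this basis are homomorphisms from \<open>G\<close> to \<open>\<rat>\<close>, and a common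
  denominator \<open>a\<close> of their values on the finitely many generators makes them integral on all of \<open>G\<close>.
  The three basis elements are then mapped to \<open>a\<close> times the unit vectors.\<close>

lemma homomorphism_of_betti_number_3:
  fixes G :: "('a, 'b) monoid_scheme"
  assumes G: "group G" and fin: "finite X"
    and \<pi>: "\<pi> \<in> hom (free_group X) G" and surj: "\<pi> ` carrier (free_group X) = carrier G"
    and betti: "betti_number G 1 = 3"
  shows "\<exists>(\<theta> :: 'a \<Rightarrow> int \<times> int \<times> int) a. a > 0 \<and>
    (\<forall>g\<in>carrier G. \<forall>h\<in>carrier G. \<theta> (g \<otimes>\<^bsub>G\<^esub> h) = \<theta> g + \<theta> h) \<and>
    {(int a, 0, 0), (0, int a, 0), (0, 0, int a)} \<subseteq> \<theta> ` carrier G"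
proof -
  interpret bar_degree_one G
    by (simp add: bar_degree_one_def G)
  interpret \<pi>: group_hom "free_group X" G \<pi>
    by (intro group_hom.intro group_hom_axioms.intro group_free_group \<pi> is_group)
  let ?T = "(\<lambda>i. hcls (\<pi> [(i, True)])) ` X"
  have letter: "\<pi> [p] \<in> carrier G" if "fst p \<in> X" for p
    using that by (simp add: singleton_in_free_group)
  have T: "?T \<subseteq> carrier H"
    using letter by (auto intro!: hcls_closed)
  have "\<exists>\<beta>\<subseteq>?T. minimal \<beta> (\<lambda>S. S \<subseteq> carrier H \<and> H.gen_set S)"
    using fin T gen_set_generators[OF \<pi> surj] by (intro minimal_exists) auto
  then obtain \<beta> where \<beta>: "\<beta> \<subseteq> ?T" and min: "minimal \<beta> (\<lambda>S. S \<subseteq> carrier H \<and> H.gen_set S)"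
    by blast
  have basis: "H.basis \<beta>"
    by (rule H.min_gen_is_basis[OF min])
  have finb: "finite \<beta>"
    using \<beta> fin finite_subset by blast
  have "card \<beta> = 3"
    using H.dim_basis[OF finb basis] betti by (simp add: betti_number_def H_def)
  then obtain b1 b2 b3 where b: "\<beta> = {b1, b2, b3}" "b1 \<noteq> b2" "b2 \<noteq> b3" "b1 \<noteq> b3"
    by (auto simp: card_3_iff)
  have "\<exists>g\<in>carrier G. hcls g = c" if "c \<in> \<beta>" for c
    using that \<beta> letter by fastforce
  then have "\<exists>g\<in>carrier G. hcls g = b1" "\<exists>g\<in>carrier G. hcls g = b2" "\<exists>g\<in>carrier G. hcls g = b3"
    by (simp_all add: b(1))
  then obtain g1 g2 g3 where g: "g1 \<in> carrier G" "hcls g1 = b1" "g2 \<in> carrier G" "hcls g2 = b2"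
      "g3 \<in> carrier G" "hcls g3 = b3"
    by blast
  obtain co :: "_ \<Rightarrow> _ \<Rightarrow> rat" where co_add: "\<forall>v\<in>carrier H. \<forall>w\<in>carrier H. \<forall>c\<in>\<beta>.
      co (v \<oplus>\<^bsub>H\<^esub> w) c = co v c \<oplus>\<^bsub>class_ring\<^esub> co w c"
    and co_basis: "\<forall>b\<in>\<beta>. \<forall>c\<in>\<beta>. co b c = (if c = b then \<one>\<^bsub>class_ring\<^esub> else \<zero>\<^bsub>class_ring\<^esub>)"
    using H.basis_coordinates[OF finb basis] by (elim exE conjE)
  define f :: "('a list \<Rightarrow>\<^sub>0 rat) set \<Rightarrow> 'a \<Rightarrow> rat" where "f c g = co (hcls g) c" for c g
  have f_mult: "f c (g \<otimes>\<^bsub>G\<^esub> h) = f c g + f c h" if "g \<in> carrier G" "h \<in> carrier G" "c \<in> \<beta>" for c g h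
    using that by (simp add: f_def hcls_mult co_add hcls_closed)
  have f_one: "f c \<one>\<^bsub>G\<^esub> = 0" if "c \<in> \<beta>" for c
    using f_mult[OF one_closed one_closed that] by simp
  have "finite ((\<lambda>(c, p). f c (\<pi> [p])) ` (\<beta> \<times> (X \<times> UNIV)))"
    using finb fin by simp
  then obtain a where a: "a > 0" "\<forall>q\<in>(\<lambda>(c, p). f c (\<pi> [p])) ` (\<beta> \<times> (X \<times> UNIV)). of_nat a * q \<in> \<int>"
    using rats_common_denominator by blast
  have int_letter: "of_nat a * f c (\<pi> [p]) \<in> \<int>" if "c \<in> \<beta>" "fst p \<in> X" for c p
    using a(2) that by (cases p) auto
  have int_word: "of_nat a * f c (\<pi> w) \<in> \<int>" if "w \<in> carrier (free_group X)" "c \<in> \<beta>" for c w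
    using that
  proof (induction w rule: free_group_word_induct)
    case Nil
    have "\<pi> [] = \<one>\<^bsub>G\<^esub>"
      using \<pi>.hom_one by (simp add: free_group_def)
    with Nil show ?case
      by (simp add: f_one)
  next
    case (Cons p w)
    then have "of_nat a * f c (\<pi> ([p] \<otimes>\<^bsub>free_group X\<^esub> w)) = of_nat a * f c (\<pi> [p]) + of_nat a * f c (\<pi> w)"
      using letter[OF Cons(1)] by (simp add: singleton_in_free_group f_mult distrib_left)
    then show ?case
      using Cons int_letter by simp
  qed
  have int: "of_nat a * f c g \<in> \<int>" if "g \<in> carrier G" "c \<in> \<beta>" for c g
    using that int_word surj by (metis imageE)
  define F where "F c g = \<lfloor>of_nat a * f c g\<rfloor>" for c g
  have F: "of_int (F c g) = of_nat a * f c g" if "g \<in> carrier G" "c \<in> \<beta>" for c g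
    using int[OF that] by (auto simp: F_def elim: Ints_cases)
  have F_mult: "F c (g \<otimes>\<^bsub>G\<^esub> h) = F c g + F c h" if "g \<in> carrier G" "h \<in> carrier G" "c \<in> \<beta>" for c g h
  proof -
    have "of_int (F c (g \<otimes>\<^bsub>G\<^esub> h)) = (of_int (F c g + F c h) :: rat)"
      using that by (simp add: F f_mult distrib_left)
    then show ?thesis
      by (simp only: of_int_eq_iff)
  qed
  have F_basis: "F c g = (if hcls g = c then int a else 0)" if "g \<in> carrier G" "hcls g \<in> \<beta>" "c \<in> \<beta>" for c g
    using that by (auto simp: F_def f_def co_basis)
  show ?thesis
  proof (intro exI[of _ "\<lambda>g. (F b1 g, F b2 g, F b3 g)"] exI[of _ a] conjI ballI)
    show "(F b1 (g \<otimes>\<^bsub>G\<^esub> h), F b2 (g \<otimes>\<^bsub>G\<^esub> h), F b3 (g \<otimes>\<^bsub>G\<^esub> h)) =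
        (F b1 g, F b2 g, F b3 g) + (F b1 h, F b2 h, F b3 h)"
      if "g \<in> carrier G" "h \<in> carrier G" for g h
      using that b by (simp add: F_mult)
    show "a > 0"
      by (fact a(1))
    have "(F b1 g1, F b2 g1, F b3 g1) = (int a, 0, 0)"
      "(F b1 g2, F b2 g2, F b3 g2) = (0, int a, 0)"
      "(F b1 g3, F b2 g3, F b3 g3) = (0, 0, int a)"
      using g b by (simp_all add: F_basis)
    then show "{(int a, 0, 0), (0, int a, 0), (0, 0, int a)} \<subseteq> (\<lambda>g. (F b1 g, F b2 g, F b3 g)) ` carrier G"
      using g(1,3,5) by (metis (mono_tags, lifting) empty_subsetI image_eqI insert_subset)
  qed
qed


section \<open>Nilpotent groups with a balanced presentation and first Betti number three\<close>

theorem corollary9: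
  fixes G :: "('a, 'b) monoid_scheme"
  assumes "nilpotent_group G"
    and "has_balanced_presentation G"
    and "betti_number G 1 = 3"
  shows "G \<cong> integer_group \<times>\<times> integer_group \<times>\<times> integer_group"
proof -
  interpret nilpotent_group G by fact
  obtain n rs where rs: "set rs \<subseteq> carrier (free_group {..<n})" "length rs = n"
    and iso: "G \<cong> presented_group {..<n} (set rs)"
    using assms(2) unfolding has_balanced_presentation_def by blast
  obtain \<pi> where \<pi>: "\<pi> \<in> hom (free_group {..<n}) G" "\<pi> ` carrier (free_group {..<n}) = carrier G"
    "\<And>r. r \<in> set rs \<Longrightarrow> \<pi> r = \<one>\<^bsub>G\<^esub>"
    "\<And>w. w \<in> carrier (free_group {..<n}) \<Longrightarrow> \<pi> w = \<one>\<^bsub>G\<^esub> \<Longrightarrow>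
      w \<in> normal_closure (free_group {..<n}) (set rs)"
    using presentation_homomorphism[OF is_group rs(1) iso] by blast
  obtain \<theta> :: "'a \<Rightarrow> int \<times> int \<times> int" and a :: nat where a: "a > 0" and
    \<theta>: "\<forall>g\<in>carrier G. \<forall>h\<in>carrier G. \<theta> (g \<otimes>\<^bsub>G\<^esub> h) = \<theta> g + \<theta> h" and
    E: "{(int a, 0, 0), (0, int a, 0), (0, 0, int a)} \<subseteq> \<theta> ` carrier G"
    using homomorphism_of_betti_number_3[OF is_group finite_lessThan \<pi>(1,2) assms(3)]
    by (elim exE conjE) (rule that)
  have E: "\<exists>g\<in>carrier G. \<theta> g = t" if "t \<in> {(int a, 0, 0), (0, int a, 0), (0, 0, int a)}" for t
  proof -
    have "t \<in> \<theta> ` carrier G"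
      using E that by (rule subsetD)
    then show ?thesis
      by blast
  qed
  interpret cover: presented_cover G n rs \<pi> \<theta>
    by unfold_locales (simp_all add: rs(1) \<pi> \<theta>)
  obtain c where "lower_central_series G c = {\<one>\<^bsub>G\<^esub>}"
    using nilpotent by blast
  from cover.kernel_trivial[OF this rs(2) a E] have "cover.K = {\<one>\<^bsub>G\<^esub>}" .
  then have "g = \<one>\<^bsub>G\<^esub>" if "g \<in> carrier G" "\<theta> g = 0" for g
    using that by (auto simp: cover.K_def)
  then show ?thesis
    using \<theta> a E by (intro iso_integers_cubed[of \<theta> a]) auto
qed

end
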